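(* Let $D\ge 1$, $\lambda>0$, $\phi\in(0,\pi/2]$, put $c_1=\frac{\lambda^{-1}}{4}\sin^2\phi$ and $c_2=\lambda^{-1}c_1(1-\cos\phi)$, and let $\Phi\in C^2(\mathbb{R}^D)$ satisfy: (H1) $\Phi(q)\ge 0$ for all $q$ and $\int_{\mathbb{R}^D}|q|^2e^{-\Phi(q)}\,dq<\infty$; (H2) there exist $a>0$ and $b\in(0,1)$ such that $$\tfrac12\langle\nabla\Phi(q),q\rangle\ \ge\ b\,\Phi(q)+\frac{(c_1b)^2+c_2b(1-b)}{2(1-b)}|q|^2-a\qquad\text{for all } q\in\mathbb{R}^D.$$ Let $\Pi_{t,z}$ be the transition probabilities of the RHMC process. Then for every compact set $\Omega\subset\mathbb{R}^{2D}$, there exist a probability measure $\eta$ over $\Omega$, $\epsilon>0$ and $t>0$ such that $$\Pi_{t,z}(\cdot)\ge\epsilon\,\eta(\cdot)$$ holds for all $z\in\Omega$.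
   Context: Let $\theta_t:\mathbb{R}^{2D}\to\mathbb{R}^{2D}$ be the flow of Hamilton's equations $\dot q=p$, $\dot p=-\nabla\Phi(q)$ (globally defined since $\Phi\ge 0$). Momentum randomization: $\Gamma(q,p)=(q,\cos(\phi)p+\sin(\phi)\xi)$ with $\xi\sim\mathcal N(0,1)^D$ a standard $D$-dimensional Gaussian vector. RHMC process $Z_t=(Q_t,P_t)$ with mean duration $\lambda$ and angle $\phi$, started at $Z_0=z$: the càdlàg Markov process with jump times $t_0=0$, $t_{n+1}=t_n+\delta t_n$, where $\delta t_n$ are i.i.d. exponential with mean $\lambda$; for $t_n\le s<t_{n+1}$, $Z_s=\theta_{s-t_n}(Z_{t_n})$, and $Z_{t_{n+1}}=\Gamma(\theta_{\delta t_n}(Z_{t_n}))$, a fresh independent Gaussian vector $\xi$ being used at each jump, all the $\delta t_n$ and Gaussian vectors being mutually independent. $\Pi_{t,z}$ denotes the law of $Z_t$ given $Z_0=z$. The inequality between measures is understood on all measurable sets.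
   Formalization: The measure η is asserted to be concentrated on Ω only when Ω has positive Lebesgue measure; for Lebesgue-null Ω (where the claim fails, e.g. Ω empty or two distinct points) η is a probability measure on ℝ^{2D}. *)

theory Defs
  imports "HOL-Probability.Probability"
begin

definition gradient :: "('a::real_inner \<Rightarrow> real) \<Rightarrow> 'a \<Rightarrow> 'a" where
  "gradient f x = (THE g. GDERIV f x :> g)"

text \<open>The derivative of the gradient (the Hessian) is required to be continuous in operator norm,
  which in finite dimension is the same as continuity of all second-order partial derivatives.\<close>

definition C2 :: "('a::euclidean_space \<Rightarrow> real) \<Rightarrow> bool" where
  "C2 f \<longleftrightarrow> (\<exists>(g :: 'a \<Rightarrow> 'a) (H :: 'a \<Rightarrow> 'a \<Rightarrow>\<^sub>L 'a).
      (\<forall>x. GDERIV f x :> g x) \<and>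
      (\<forall>x. (g has_derivative blinfun_apply (H x)) (at x)) \<and>
      continuous_on UNIV H)"

text \<open>Phase space \<open>\<real>\<^sup>2\<^sup>D\<close>: position first, momentum second, with \<open>D = CARD('n)\<close>.\<close>

type_synonym 'n phase = "(real ^ 'n) \<times> (real ^ 'n)"

definition is_hamiltonian_flow ::
    "(real ^ 'n \<Rightarrow> real) \<Rightarrow> (real \<Rightarrow> 'n::finite phase \<Rightarrow> 'n phase) \<Rightarrow> bool" where
  "is_hamiltonian_flow \<Phi> \<theta> \<longleftrightarrow>
     (\<forall>z. \<theta> 0 z = z \<and>
        (\<forall>t. ((\<lambda>s. \<theta> s z) has_vector_derivative
              (snd (\<theta> t z), - gradient \<Phi> (fst (\<theta> t z)))) (at t)))"

text \<open>For \<open>\<Phi>\<close> nonnegative and twice continuously differentiable, Hamilton's equations have exactly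
  one global solution through each point, so the description below is proper.\<close>

definition hamiltonian_flow ::
    "(real ^ 'n \<Rightarrow> real) \<Rightarrow> real \<Rightarrow> 'n::finite phase \<Rightarrow> 'n phase" where
  "hamiltonian_flow \<Phi> = (THE \<theta>. is_hamiltonian_flow \<Phi> \<theta>)"

definition momentum_randomization :: "real \<Rightarrow> real ^ 'n \<Rightarrow> 'n::finite phase \<Rightarrow> 'n phase" where
  "momentum_randomization \<phi> \<xi> z = (fst z, cos \<phi> *\<^sub>R snd z + sin \<phi> *\<^sub>R \<xi>)"

definition std_gaussian :: "(real ^ 'n::finite) measure" where
  "std_gaussian = density lborel (\<lambda>x. ennreal (\<Prod>i\<in>UNIV. std_normal_density (x $ i)))"

text \<open>The canonical driving noise: the \<open>n\<close>-th coordinate of a sample is the pair of the waiting time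
  \<open>\<delta>t\<^sub>n\<close> and the Gaussian vector used at the jump that ends it. The product measure
  makes all of these independent. Mean \<open>lam\<close> is rate \<open>1 / lam\<close>.\<close>

definition rhmc_noise :: "real \<Rightarrow> (nat \<Rightarrow> real \<times> (real ^ 'n::finite)) measure" where
  "rhmc_noise lam =
     Pi\<^sub>M UNIV (\<lambda>_. density lborel (exponential_density (1 / lam)) \<Otimes>\<^sub>M std_gaussian)"

definition jump_time :: "(nat \<Rightarrow> real \<times> (real ^ 'n::finite)) \<Rightarrow> nat \<Rightarrow> real" where
  "jump_time \<omega> n = (\<Sum>k<n. fst (\<omega> k))"

primrec jump_state ::
    "(real ^ 'n \<Rightarrow> real) \<Rightarrow> real \<Rightarrow> 'n::finite phase \<Rightarrow> (nat \<Rightarrow> real \<times> (real ^ 'n)) \<Rightarrow> nat \<Rightarrow> 'n phase" where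
  "jump_state \<Phi> \<phi> z \<omega> 0 = z"
| "jump_state \<Phi> \<phi> z \<omega> (Suc n) =
     momentum_randomization \<phi> (snd (\<omega> n)) (hamiltonian_flow \<Phi> (fst (\<omega> n)) (jump_state \<Phi> \<phi> z \<omega> n))"

text \<open>Almost surely the waiting times are positive and the jump times tend to infinity, so that for
  \<open>s \<ge> 0\<close> exactly one index satisfies the condition under \<open>LEAST\<close>; on the exceptional null set
  the value is irrelevant.\<close>

definition rhmc_process ::
    "(real ^ 'n \<Rightarrow> real) \<Rightarrow> real \<Rightarrow> 'n::finite phase \<Rightarrow> real \<Rightarrow> (nat \<Rightarrow> real \<times> (real ^ 'n)) \<Rightarrow> 'n phase" where
  "rhmc_process \<Phi> \<phi> z s \<omega> =
     (let n = (LEAST n. jump_time \<omega> n \<le> s \<and> s < jump_time \<omega> (Suc n))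
      in hamiltonian_flow \<Phi> (s - jump_time \<omega> n) (jump_state \<Phi> \<phi> z \<omega> n))"

text \<open>The transition probability \<open>\<Pi>\<^bsub>t,z\<^esub>\<close>: the law of \<open>Z\<^sub>t\<close> when \<open>Z\<^sub>0 = z\<close>.\<close>

definition rhmc_law ::
    "real \<Rightarrow> real \<Rightarrow> (real ^ 'n \<Rightarrow> real) \<Rightarrow> real \<Rightarrow> 'n::finite phase \<Rightarrow> 'n phase measure" where
  "rhmc_law lam \<phi> \<Phi> t z = distr (rhmc_noise lam) borel (rhmc_process \<Phi> \<phi> z t)"

end

theory Submission
  imports Defs
begin

text \<open>The driving noise has a part of positive probability on which \<open>Z\<^sub>t\<close> is a locally Lipschitz
  function of two Gaussian vectors, for frozen waiting times: the part where exactly two jumps happen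
  up to time \<open>t\<close>. Each of the two vectors has \<open>D\<close> components and phase space has dimension \<open>2 D\<close>, so
  there is just enough randomness to spread \<open>Z\<^sub>t\<close> over an open set. Let \<open>B\<close> be a ball around the origin
  that contains \<open>\<Omega>\<close>, with radius \<open>R\<close>. It is enough to find \<open>t\<close> and
  \<open>c > 0\<close> such that \<open>\<Pi>\<^bsub>t,z\<^esub>(A) \<ge> c Leb(A \<inter> B)\<close> for all \<open>z\<close> in \<open>B\<close>; then \<open>\<eta>\<close> can be the
  normalized Lebesgue measure on \<open>\<Omega>\<close>, or on \<open>B\<close> if \<open>\<Omega>\<close> is a null set.

  \<^emph>\<open>Reachability.\<close> Let the jumps happen after waiting times \<open>s\<close> and \<open>s'\<close>, both between \<open>\<tau>/2\<close> and \<open>\<tau>\<close>,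
  and put \<open>t = 3 \<tau>\<close>. To hit a target \<open>y\<close>, flow \<open>y\<close> backwards over the time that remains after the
  second jump. This gives a position and a momentum. The second jump can produce any momentum, so
  what is left is to connect two given positions by the motion between the jumps, where the first
  jump offers any initial momentum. For small \<open>\<tau>\<close> the motion is almost straight, with momentum of
  order \<open>R/\<tau>\<close>, and Brouwer's theorem provides the momentum (\<open>shooting\<close>, \<open>two_jumps_onto\<close>). The
  Gaussian vectors used in this way stay in a ball that depends neither on the starting point and the
  target in \<open>B\<close> nor on the waiting times.

  \<^emph>\<open>Density.\<close> On that ball, the map from the two Gaussian vectors to \<open>Z\<^sub>t\<close> is Lipschitz, uniformly in
  the starting point and the waiting times (\<open>two_jumps_lipschitz\<close>). A Lipschitz map between spaces of
  the same dimension enlarges Lebesgue measure at most by a constant factor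
  (\<open>emeasure_le_lipschitz_image\<close>), so a map that moreover covers \<open>B\<close> pushes Lebesgue measure forward to
  something that is at least a multiple of Lebesgue measure on \<open>B\<close>; covering replaces the change of
  variables formula here. The Gaussian density is bounded below on the ball, and the conditions on the
  three waiting times involved have positive probability.

  \<^emph>\<open>The flow.\<close> All this presupposes that the Hamiltonian flow exists, is unique and is locally
  Lipschitz in the initial state. Conservation of energy together with \<open>\<Phi> \<ge> 0\<close> bounds the momentum for
  all times, hence the position on every bounded time interval, so the force may be replaced by a
  globally Lipschitz one, for which Picard iteration converges; Gronwall's inequality does the rest.\<close>

section \<open>Lipschitz images and Lebesgue measure\<close>

text \<open>Inside an open set that contains \<open>S\<close> and is only slightly larger, countably many cubes with disjoint
  interiors cover \<open>S\<close>. A cube of side \<open>l\<close> has diameter at most \<open>d l\<close> in dimension \<open>d\<close>, so the image of its part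
  in \<open>S\<close> fits into a cube of side \<open>2 L d l\<close>. The claim is about a measurable \<open>T\<close> below the image
  because the image itself may fail to be a Borel set.\<close>

lemma emeasure_le_lipschitz_image:
  fixes f :: "'a::euclidean_space \<Rightarrow> 'a"
  assumes lip: "L-lipschitz_on S f" and "bounded S"
    and S: "S \<in> sets borel" and T: "T \<in> sets borel" and TS: "T \<subseteq> f ` S"
  shows "emeasure lborel T \<le> ennreal ((2 * L * DIM('a)) ^ DIM('a)) * emeasure lborel S"
proof -
  define d where "d = DIM('a)"
  define C where "C = (2 * L * d) ^ d"
  have L: "0 \<le> L" using lip by (rule lipschitz_on_nonneg)
  have C: "0 \<le> C" using L by (simp add: C_def)
  obtain M where M: "M > 0" "\<And>x. x \<in> S \<Longrightarrow> norm x \<le> M"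
    using \<open>bounded S\<close> unfolding bounded_pos by blast
  define b where "b = M *\<^sub>R (One::'a)"
  have S_box: "S \<subseteq> cbox (- b) b"
  proof
    fix x assume "x \<in> S"
    then have "\<bar>x \<bullet> i\<bar> \<le> M" if "i \<in> Basis" for i
      using M(2) Basis_le_norm[OF that, of x] by force
    then show "x \<in> cbox (- b) b"
      by (auto simp: mem_box b_def abs_le_iff) (smt (verit))
  qed
  have box_ne: "box (- b) b \<noteq> {}"
    using M(1) by (auto simp: box_ne_empty b_def)
  have est: "emeasure lborel T \<le> ennreal C * emeasure lborel U" if U: "open U" "S \<subseteq> U" for U
  proof -
    have "\<forall>x. \<exists>e>0. x \<in> U \<longrightarrow> ball x e \<subseteq> U"
      using U(1) by (metis open_contains_ball zero_less_one)
    then obtain r where r: "\<And>x. r x > 0" "\<And>x. x \<in> U \<Longrightarrow> ball x (r x) \<subseteq> U" by metis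
    have gau: "gauge (\<lambda>x. ball x (r x))" using r(1) by (rule gauge_ball_dependent[rule_format])
    obtain D where D: "countable D" "\<Union>D \<subseteq> cbox (- b) b"
      "\<And>K. K \<in> D \<Longrightarrow> interior K \<noteq> {} \<and> (\<exists>c d. K = cbox c d)"
      "pairwise (\<lambda>A B. interior A \<inter> interior B = {}) D"
      "\<And>K. K \<in> D \<Longrightarrow> \<exists>x \<in> S \<inter> K. K \<subseteq> ball x (r x)"
      "\<And>u v. cbox u v \<in> D \<Longrightarrow> \<exists>n. \<forall>i \<in> Basis. v \<bullet> i - u \<bullet> i = (b \<bullet> i - (- b) \<bullet> i) / 2^n"
      "S \<subseteq> \<Union>D" 
    proof (rule covering_lemma[OF S_box box_ne gau], goal_cases)
      case (1 D)
      show ?case by (rule 1(1)[OF 1(2-8)])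
    qed
    have cube: "\<exists>B. B \<in> sets borel \<and> f ` (S \<inter> K) \<subseteq> B \<and>
        emeasure lborel B \<le> ennreal C * emeasure lborel (interior K)" if K: "K \<in> D" for K
    proof -
      obtain u v where uv: "K = cbox u v" using D(3)[OF K] by blast
      obtain n where n: "\<And>i. i \<in> Basis \<Longrightarrow> v \<bullet> i - u \<bullet> i = (b \<bullet> i - (- b) \<bullet> i) / 2^n"
        using D(6) K uv by blast
      define l where "l = 2 * M / 2 ^ n"
      have l: "l > 0" using M(1) by (simp add: l_def)
      have side: "v \<bullet> i - u \<bullet> i = l" if "i \<in> Basis" for i
        using n[OF that] that by (simp add: b_def l_def)
      obtain x where x: "x \<in> S" "x \<in> K" using D(5)[OF K] by blast
      define h where "h = L * (d * l)"
      have h: "h \<ge> 0" using L l by (simp add: h_def)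
      define B where "B = cbox (f x - h *\<^sub>R One) (f x + h *\<^sub>R One)"
      have "f y \<in> B" if y: "y \<in> S" "y \<in> K" for y
      proof -
        have "norm (y - x) \<le> (\<Sum>i\<in>Basis. \<bar>(y - x) \<bullet> i\<bar>)" by (rule norm_le_l1)
        also have "\<dots> \<le> (\<Sum>i\<in>(Basis::'a set). l)"
        proof (rule sum_mono)
          fix i :: 'a assume i: "i \<in> Basis"
          then show "\<bar>(y - x) \<bullet> i\<bar> \<le> l"
            using x(2) y(2) side[OF i] i unfolding uv mem_box by (auto simp: inner_diff_left abs_le_iff) (smt (verit))+
        qed
        finally have "norm (y - x) \<le> d * l" by (simp add: d_def)
        then have *: "norm (f y - f x) \<le> h"
          using lipschitz_onD[OF lip y(1) x(1)] L unfolding h_def dist_norm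
          by (meson mult_left_mono order_trans)
        have "\<bar>f y \<bullet> i - f x \<bullet> i\<bar> \<le> h" if "i \<in> Basis" for i
          using Basis_le_norm[OF that, of "f y - f x"] * by (simp add: inner_diff_left)
        then show ?thesis
          unfolding B_def mem_box by (auto simp: inner_diff_left inner_add_left abs_le_iff) (smt (verit))+
      qed
      then have 1: "f ` (S \<inter> K) \<subseteq> B" by blast
      have "emeasure lborel B = ennreal ((2 * h) ^ d)"
        using h by (simp add: B_def emeasure_lborel_cbox_eq inner_diff_left inner_add_left d_def)
      also have "(2 * h) ^ d = C * l ^ d"
        by (simp add: h_def C_def power_mult_distrib)
      also have "ennreal (C * l ^ d) = ennreal C * ennreal (l ^ d)"
        using C l by (simp add: ennreal_mult)
      also have "ennreal (l ^ d) = emeasure lborel (interior K)"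
      proof -
        have "u \<bullet> i \<le> v \<bullet> i" if "i \<in> Basis" for i using side[OF that] l by simp
        then show ?thesis
          using side by (simp add: uv emeasure_lborel_box_eq d_def inner_diff_left)
      qed
      finally have "emeasure lborel B \<le> ennreal C * emeasure lborel (interior K)" by simp
      with 1 show ?thesis by (auto simp: B_def intro!: exI[of _ B])
    qed
    then obtain B where B: "\<And>K. K \<in> D \<Longrightarrow> B K \<in> sets borel" "\<And>K. K \<in> D \<Longrightarrow> f ` (S \<inter> K) \<subseteq> B K"
      "\<And>K. K \<in> D \<Longrightarrow> emeasure lborel (B K) \<le> ennreal C * emeasure lborel (interior K)"
      by metis
    \<comment> \<open>The countable family of cubes is enumerated by \<open>N\<close>; the sequences \<open>X\<close> and \<open>Y\<close> are empty off \<open>N\<close>.\<close>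
    define N where "N = to_nat_on D ` D"
    define k where "k = from_nat_into D"
    have k: "k n \<in> D" if "n \<in> N" for n using that D(1) by (auto simp: N_def k_def)
    have inj: "m = n" if "m \<in> N" "n \<in> N" "k m = k n" for m n
      using that D(1) by (auto simp: N_def k_def)
    have surj: "\<exists>n\<in>N. k n = K" if "K \<in> D" for K
      using that D(1) by (auto simp: N_def k_def)
    define X where "X n = (if n \<in> N then B (k n) else {})" for n
    define Y where "Y n = (if n \<in> N then interior (k n) else {})" for n
    have X: "X n \<in> sets lborel" for n using B(1) k by (simp add: X_def)
    have Y: "Y n \<in> sets lborel" for n by (simp add: Y_def)
    have "T \<subseteq> (\<Union>n. X n)"
    proof
      fix y assume "y \<in> T"
      then obtain x K where "x \<in> S" "y = f x" "K \<in> D" "x \<in> K" using TS D(7) by blast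
      then show "y \<in> (\<Union>n. X n)" using B(2)[of K] surj[of K] by (auto simp: X_def)
    qed
    then have "emeasure lborel T \<le> emeasure lborel (\<Union>n. X n)"
      using X by (intro emeasure_mono) auto
    also have "\<dots> \<le> (\<Sum>n. emeasure lborel (X n))"
      using X by (intro emeasure_subadditive_countably) auto
    also have "\<dots> \<le> (\<Sum>n. ennreal C * emeasure lborel (Y n))"
      using B(3) k by (intro suminf_le) (auto simp: X_def Y_def)
    also have "\<dots> = ennreal C * (\<Sum>n. emeasure lborel (Y n))"
      by simp
    also have "(\<Sum>n. emeasure lborel (Y n)) = emeasure lborel (\<Union>n. Y n)"
    proof (intro suminf_emeasure)
      show "disjoint_family Y"
        using D(4) k inj unfolding disjoint_family_on_def pairwise_def Y_def by (simp) metis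
    qed (use Y in auto)
    also have "\<dots> \<le> emeasure lborel U"
    proof (intro emeasure_mono)
      show "(\<Union>n. Y n) \<subseteq> U"
      proof
        fix y assume "y \<in> (\<Union>n. Y n)"
        then obtain n where "n \<in> N" "y \<in> interior (k n)"
          by (auto simp: Y_def split: if_splits)
        then obtain K where K: "K \<in> D" "y \<in> K" using interior_subset k by blast
        then obtain x where "x \<in> S" "K \<subseteq> ball x (r x)" using D(5) by blast
        then show "y \<in> U" using r(2)[of x] U(2) K(2) by blast
      qed
    qed (use U(1) in auto)
    finally show ?thesis by (simp add: mult_left_mono)
  qed
  have "emeasure lborel T \<le> ennreal C * emeasure lborel S"
  proof (rule ennreal_le_epsilon)
    fix e :: real assume e: "0 < e"
    define e' where "e' = e / (C + 1)"
    have e': "e' > 0" "C * e' \<le> e" using e C by (auto simp: e'_def field_simps)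
    obtain U where U: "open U" "S \<subseteq> U" "emeasure lborel (U - S) < ennreal e'"
      using outer_regular_lborel[OF S e'(1)] by blast
    have "emeasure lborel T \<le> ennreal C * emeasure lborel U" by (rule est[OF U(1,2)])
    also have "emeasure lborel U = emeasure lborel S + emeasure lborel (U - S)"
      using U S by (subst plus_emeasure) (auto simp: Un_absorb1)
    also have "ennreal C * \<dots> \<le> ennreal C * (emeasure lborel S + ennreal e')"
      using U(3) by (intro mult_left_mono add_left_mono) auto
    also have "\<dots> = ennreal C * emeasure lborel S + ennreal (C * e')"
      using C e' by (simp add: distrib_left ennreal_mult)
    also have "\<dots> \<le> ennreal C * emeasure lborel S + ennreal e"
      using e'(2) by (intro add_left_mono ennreal_leI)
    finally show "emeasure lborel T \<le> ennreal C * emeasure lborel S + ennreal e" .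
  qed
  then show ?thesis by (simp add: C_def d_def)
qed

section \<open>Ordinary differential equations with a Lipschitz field\<close>

text \<open>The function \<open>exp (- 2 L s) (dist (x s) (y s))\<^sup>2\<close> is differentiable and nonincreasing.\<close>

lemma gronwall_forward:
  fixes x y :: "real \<Rightarrow> 'a::real_inner"
  assumes lip: "L-lipschitz_on D f" and "0 \<le> t"
    and x: "\<And>s. 0 \<le> s \<Longrightarrow> s \<le> t \<Longrightarrow> (x has_vector_derivative f (x s)) (at s)"
    and y: "\<And>s. 0 \<le> s \<Longrightarrow> s \<le> t \<Longrightarrow> (y has_vector_derivative f (y s)) (at s)"
    and D: "\<And>s. 0 \<le> s \<Longrightarrow> s \<le> t \<Longrightarrow> x s \<in> D \<and> y s \<in> D"
  shows "dist (x t) (y t) \<le> exp (L * t) * dist (x 0) (y 0)"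
proof -
  define u where "u s = exp (- 2 * L * s) * ((x s - y s) \<bullet> (x s - y s))" for s
  have "u t \<le> u 0"
  proof (rule DERIV_nonpos_imp_nonincreasing[OF \<open>0 \<le> t\<close>])
    fix s assume s: "0 \<le> s" "s \<le> t"
    let ?d = "2 * ((x s - y s) \<bullet> (f (x s) - f (y s)))"
    have "((\<lambda>s. (x s - y s) \<bullet> (x s - y s)) has_real_derivative ?d) (at s)"
      unfolding has_field_derivative_def
      by (rule has_derivative_eq_rhs, rule has_derivative_inner
          [OF has_vector_derivative_diff[OF x[OF s] y[OF s], unfolded has_vector_derivative_def]
              has_vector_derivative_diff[OF x[OF s] y[OF s], unfolded has_vector_derivative_def]])
         (auto simp: inner_commute)
    from DERIV_mult[OF _ this, of "\<lambda>s. exp (- 2 * L * s)" "exp (- 2 * L * s) * (- 2 * L)"]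
    have "(u has_real_derivative exp (- 2 * L * s) * (?d - 2 * L * ((x s - y s) \<bullet> (x s - y s)))) (at s)"
      unfolding u_def by (rule DERIV_cong) (auto intro!: derivative_eq_intros simp: algebra_simps)
    moreover have "?d \<le> 2 * L * ((x s - y s) \<bullet> (x s - y s))"
    proof -
      have "(x s - y s) \<bullet> (f (x s) - f (y s)) \<le> norm (x s - y s) * norm (f (x s) - f (y s))"
        by (rule norm_cauchy_schwarz)
      also have "\<dots> \<le> norm (x s - y s) * (L * norm (x s - y s))"
        using lipschitz_onD[OF lip, of "x s" "y s"] D[OF s] by (intro mult_left_mono) (auto simp: dist_norm)
      finally show ?thesis
        by (simp add: power2_norm_eq_inner[symmetric] power2_eq_square ac_simps)
    qed
    ultimately show "\<exists>y. (u has_real_derivative y) (at s) \<and> y \<le> 0"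
      by (intro exI conjI) (assumption, simp add: mult_nonneg_nonpos)
  qed
  then have "exp (2 * L * t) * u t \<le> exp (2 * L * t) * u 0" by simp
  then have "(norm (x t - y t))\<^sup>2 \<le> (exp (L * t) * norm (x 0 - y 0))\<^sup>2"
    by (simp add: u_def mult.assoc[symmetric] exp_add[symmetric] power_mult_distrib
        power2_norm_eq_inner exp_double[symmetric])
  then show ?thesis
    unfolding dist_norm by (rule power2_le_imp_le) simp
qed

lemma has_vector_derivative_reflect:
  fixes x :: "real \<Rightarrow> 'a::real_normed_vector"
  assumes "(x has_vector_derivative v) (at (- t))"
  shows "((\<lambda>s. x (- s)) has_vector_derivative - v) (at t)"
proof -
  have "((\<lambda>s::real. - s) has_vector_derivative - 1) (at t)"
    by (auto intro!: derivative_eq_intros)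
  from vector_diff_chain_at[OF this, of x v] assms show ?thesis by (simp add: o_def)
qed

lemma gronwall:
  fixes x y :: "real \<Rightarrow> 'a::real_inner"
  assumes lip: "L-lipschitz_on D f"
    and x: "\<And>s. s \<in> closed_segment 0 t \<Longrightarrow> (x has_vector_derivative f (x s)) (at s)"
    and y: "\<And>s. s \<in> closed_segment 0 t \<Longrightarrow> (y has_vector_derivative f (y s)) (at s)"
    and D: "\<And>s. s \<in> closed_segment 0 t \<Longrightarrow> x s \<in> D \<and> y s \<in> D"
  shows "dist (x t) (y t) \<le> exp (L * \<bar>t\<bar>) * dist (x 0) (y 0)"
proof (cases "0 \<le> t")
  case True
  then show ?thesis
    using gronwall_forward[OF lip True x y D] by (simp add: closed_segment_eq_real_ivl)
next
  case False
  have lip': "L-lipschitz_on D (\<lambda>z. - f z)" using lip by (rule lipschitz_on_minus)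
  have "dist (x (- (- t))) (y (- (- t))) \<le> exp (L * - t) * dist (x (- 0)) (y (- 0))"
    using False
    by (intro gronwall_forward[OF lip', of "- t" "\<lambda>s. x (- s)" "\<lambda>s. y (- s)"]
          has_vector_derivative_reflect x y D) (auto simp: closed_segment_eq_real_ivl)
  then show ?thesis using False by simp
qed

lemma antiderivative_exists:
  fixes h :: "real \<Rightarrow> 'a::euclidean_space"
  assumes "continuous_on UNIV h"
  shows "\<exists>K. K 0 = 0 \<and> (\<forall>t. (K has_vector_derivative h t) (at t))"
proof -
  have "\<And>x. isCont h x" using assms by (simp add: continuous_on_eq_continuous_at)
  then obtain F where F: "\<And>x. (F has_vector_derivative h x) (at x)"
    using einterval_antiderivative[of "-\<infinity>" "\<infinity>" h] by auto
  have "((\<lambda>t. F t - F 0) has_vector_derivative h t) (at t)" for t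
    using has_vector_derivative_diff[OF F has_vector_derivative_const] by simp
  then show ?thesis by (intro exI[of _ "\<lambda>t. F t - F 0"]) auto
qed

text \<open>Integrals against the weight \<open>exp (c |t|)\<close> gain a factor \<open>1 / c\<close>. This is what makes the Picard
  operator a contraction below.\<close>

lemma antiderivative_exp_bound_forward:
  fixes K :: "real \<Rightarrow> 'a::real_normed_vector"
  assumes "c > 0" and K0: "K 0 = 0" and t: "0 \<le> t"
    and K: "\<And>t. (K has_vector_derivative h t) (at t)"
    and h: "\<And>t. 0 \<le> t \<Longrightarrow> norm (h t) \<le> B * exp (c * t)"
  shows "norm (K t) \<le> B / c * exp (c * t)"
proof -
  have B: "0 \<le> B" using order_trans[OF norm_ge_zero h[of 0]] by simp
  consider "t = 0" | "t > 0" using t by linarith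
  then show ?thesis
  proof cases
    case 2
    have Kc: "continuous_on S K" for S
      using K by (meson has_vector_derivative_continuous continuous_at_imp_continuous_on)
    have "norm (K t - K 0) \<le> B / c * exp (c * t) - B / c * exp (c * 0)"
    proof (rule differentiable_bound_general[OF 2 Kc])
      fix s :: real assume "0 < s"
      show "((\<lambda>t. B / c * exp (c * t)) has_vector_derivative B * exp (c * s)) (at s)"
        using \<open>c > 0\<close> unfolding has_real_derivative_iff_has_vector_derivative[symmetric]
        by (auto intro!: derivative_eq_intros)
    qed (use \<open>c > 0\<close> in \<open>auto intro!: continuous_intros K h\<close>)
    also have "\<dots> \<le> B / c * exp (c * t)" using B \<open>c > 0\<close> by simp
    finally show ?thesis using K0 by simp
  qed (use K0 B \<open>c > 0\<close> in auto)
qed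

lemma antiderivative_exp_bound:
  fixes K :: "real \<Rightarrow> 'a::real_normed_vector"
  assumes "c > 0" and K0: "K 0 = 0"
    and K: "\<And>t. (K has_vector_derivative h t) (at t)"
    and h: "\<And>t. norm (h t) \<le> B * exp (c * \<bar>t\<bar>)"
  shows "norm (K t) \<le> B / c * exp (c * \<bar>t\<bar>)"
proof (cases "0 \<le> t")
  case True
  have "norm (h s) \<le> B * exp (c * s)" if "0 \<le> s" for s using h[of s] that by simp
  from antiderivative_exp_bound_forward[of c K, OF \<open>c > 0\<close> K0 True K this] True show ?thesis by simp
next
  case False
  have "norm (- h (- s)) \<le> B * exp (c * s)" if "0 \<le> s" for s using h[of "- s"] that by simp
  from antiderivative_exp_bound_forward[of c "\<lambda>s. K (- s)", OF \<open>c > 0\<close> _ _ has_vector_derivative_reflect[OF K] this, of "- t"]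
    False K0 show ?thesis by simp
qed

text \<open>Solutions are sought in the form \<open>x t = z + exp (c |t|) u t\<close> with \<open>u\<close> bounded and continuous. In the
  supremum norm of \<open>u\<close> the Picard operator is a contraction with constant \<open>L / c\<close>, so that one
  application of Banach's fixed point theorem yields a solution on the whole real line.\<close>

lemma global_solution_exists:
  fixes f :: "'a::euclidean_space \<Rightarrow> 'a"
  assumes lip: "L-lipschitz_on UNIV f"
  shows "\<exists>x. x 0 = z \<and> (\<forall>t. (x has_vector_derivative f (x t)) (at t))"
proof -
  \<comment> \<open>Any \<open>c > L\<close> makes \<open>L / c < 1\<close>; this choice is also positive for \<open>L = 0\<close>.\<close>
  define c where "c = 2 * L + 1"
  have L: "L \<ge> 0" using lip by (rule lipschitz_on_nonneg)
  have c: "c > 0" using L by (simp add: c_def)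
  have fc: "continuous_on UNIV f" using lip by (rule lipschitz_on_continuous_on)
  define X where "X u t = z + exp (c * \<bar>t\<bar>) *\<^sub>R apply_bcontfun u t" for u and t :: real
  have X_cont: "continuous_on UNIV (\<lambda>t. f (X u t))" for u
    unfolding X_def
    by (rule continuous_on_compose2[OF fc]) (auto intro!: continuous_intros)
  have "\<forall>u. \<exists>K. K 0 = 0 \<and> (\<forall>t. (K has_vector_derivative f (X u t)) (at t))"
    using antiderivative_exists[OF X_cont] by blast
  then obtain K where K0: "\<And>u. K u 0 = 0"
    and K: "\<And>u t. (K u has_vector_derivative f (X u t)) (at t)" by metis
  have dX: "norm (X u t - X v t) \<le> dist u v * exp (c * \<bar>t\<bar>)" for u v t
    using dist_bounded[of u t v] by (simp add: X_def dist_norm scaleR_diff_right[symmetric] mult.commute)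
  have dK: "norm (K u t - K v t) \<le> (L * dist u v) / c * exp (c * \<bar>t\<bar>)" for u v t
  proof (rule antiderivative_exp_bound[OF c])
    show "((\<lambda>t. K u t - K v t) has_vector_derivative f (X u s) - f (X v s)) (at s)" for s
      by (intro has_vector_derivative_diff K)
    show "norm (f (X u s) - f (X v s)) \<le> L * dist u v * exp (c * \<bar>s\<bar>)" for s
    proof -
      have "norm (f (X u s) - f (X v s)) \<le> L * norm (X u s - X v s)"
        using lipschitz_onD[OF lip, of "X u s" "X v s"] by (simp add: dist_norm)
      also have "\<dots> \<le> L * (dist u v * exp (c * \<bar>s\<bar>))"
        by (intro mult_left_mono dX L)
      finally show ?thesis by (simp add: mult.assoc)
    qed
  qed (simp add: K0)
  have X0: "X 0 t = z" for t by (simp add: X_def)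
  have K_0: "norm (K 0 t) \<le> norm (f z) / c * exp (c * \<bar>t\<bar>)" for t
  proof (rule antiderivative_exp_bound[OF c K0 K])
    show "norm (f (X 0 s)) \<le> norm (f z) * exp (c * \<bar>s\<bar>)" for s
      using c mult_left_mono[of 1 "exp (c * \<bar>s\<bar>)" "norm (f z)"] by (simp add: X0)
  qed
  have bc: "(\<lambda>t. exp (- (c * \<bar>t\<bar>)) *\<^sub>R K u t) \<in> bcontfun" for u
  proof (rule bcontfun_normI)
    have "continuous_on UNIV (K u)"
      using K by (meson has_vector_derivative_continuous continuous_at_imp_continuous_on)
    then show "continuous_on UNIV (\<lambda>t. exp (- (c * \<bar>t\<bar>)) *\<^sub>R K u t)"
      by (auto intro!: continuous_intros)
    fix t
    have "norm (K u t) \<le> norm (K 0 t) + norm (K u t - K 0 t)"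
      using norm_triangle_ineq[of "K 0 t" "K u t - K 0 t"] by simp
    also have "\<dots> \<le> (norm (f z) / c + L * dist u 0 / c) * exp (c * \<bar>t\<bar>)"
      using K_0[of t] dK[of u t 0] by (simp add: distrib_right)
    finally show "norm (exp (- (c * \<bar>t\<bar>)) *\<^sub>R K u t) \<le> norm (f z) / c + L * dist u 0 / c"
      by (simp add: exp_minus field_simps)
  qed
  define P where "P u = Bcontfun (\<lambda>t. exp (- (c * \<bar>t\<bar>)) *\<^sub>R K u t)" for u
  have P: "apply_bcontfun (P u) t = exp (- (c * \<bar>t\<bar>)) *\<^sub>R K u t" for u t
    unfolding P_def by (simp add: Bcontfun_inverse[OF bc])
  have "dist (P u) (P v) \<le> (L / c) * dist u v" for u v
  proof (rule dist_bound)
    fix t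
    show "dist (P u t) (P v t) \<le> L / c * dist u v"
    proof -
      have "dist (P u t) (P v t) = exp (- (c * \<bar>t\<bar>)) * norm (K u t - K v t)"
        by (simp add: P dist_norm scaleR_diff_right[symmetric])
      also have "\<dots> \<le> exp (- (c * \<bar>t\<bar>)) * (L * dist u v / c * exp (c * \<bar>t\<bar>))"
        using dK[of u t v] by (intro mult_left_mono) auto
      also have "\<dots> = L / c * dist u v" by (simp add: exp_minus)
      finally show ?thesis .
    qed
  qed
  then obtain u where u: "P u = u"
    using banach_fix_type[of "L / c" P] L c by (auto simp: c_def field_simps)
  have Xu: "X u t = z + K u t" for t
    using P[of u t] by (simp add: X_def u exp_minus)
  show ?thesis
  proof (intro exI[of _ "X u"] conjI allI)
    show "X u 0 = z" by (simp add: Xu K0)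
    show "(X u has_vector_derivative f (X u t)) (at t)" for t
      using has_vector_derivative_add[OF has_vector_derivative_const K, of z u t]
      by (simp add: Xu[abs_def, symmetric])
  qed
qed

section \<open>Hamiltonian motion in a nonnegative potential\<close>

text \<open>The part of the theory of Hamilton's equations that depends on the potential alone.\<close>

locale nonneg_C2_potential =
  fixes \<Phi> :: "real ^ 'n::finite \<Rightarrow> real"
  assumes C2_potential: "C2 \<Phi>" and potential_nonneg: "\<Phi> q \<ge> 0"
begin

definition field :: "'n phase \<Rightarrow> 'n phase" where
  "field z = (snd z, - gradient \<Phi> (fst z))"

definition energy :: "'n phase \<Rightarrow> real" where
  "energy z = (norm (snd z))\<^sup>2 / 2 + \<Phi> (fst z)"

text \<open>By conservation of energy and nonnegativity of the potential, this number bounds the norm of the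
  momentum along the whole motion that starts in \<open>z\<close>.\<close>

definition speed_bound :: "'n phase \<Rightarrow> real" where
  "speed_bound z = norm (snd z) + sqrt (2 * \<Phi> (fst z))"

text \<open>The segment makes the notion cover negative times \<open>t\<close> as well. The derivatives are two-sided also at
  its ends, which spares one-sided derivatives throughout.\<close>

definition motion_until :: "real \<Rightarrow> (real \<Rightarrow> 'n phase) \<Rightarrow> bool" where
  "motion_until t x \<longleftrightarrow> (\<forall>s\<in>closed_segment 0 t. (x has_vector_derivative field (x s)) (at s))"

lemma gradient_eqI: "GDERIV \<Phi> q :> g \<Longrightarrow> gradient \<Phi> q = g"
proof -
  assume g: "GDERIV \<Phi> q :> g"
  have "h = g" if "GDERIV \<Phi> q :> h" for h
  proof -
    have "(\<lambda>v. v \<bullet> h) = (\<lambda>v. v \<bullet> g)"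
      using that g unfolding gderiv_def by (rule has_derivative_unique)
    then have "(h - g) \<bullet> h = (h - g) \<bullet> g" by metis
    then show "h = g" by (metis eq_iff_diff_eq_0 inner_diff_right inner_eq_zero_iff)
  qed
  with g show ?thesis unfolding gradient_def by blast
qed

lemma has_gradient: "GDERIV \<Phi> q :> gradient \<Phi> q"
  using C2_potential gradient_eqI unfolding C2_def by metis

lemma potential_has_derivative: "(\<Phi> has_derivative (\<lambda>h. h \<bullet> gradient \<Phi> q)) (at q)"
  using has_gradient unfolding gderiv_def .

lemma potential_continuous: "continuous_on S \<Phi>"
  using potential_has_derivative has_derivative_continuous
  by (blast intro: continuous_at_imp_continuous_on)

lemma gradient_lipschitz: "\<exists>L. L-lipschitz_on (cball 0 R) (gradient \<Phi>)"
proof -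
  obtain g and H :: "real ^ 'n \<Rightarrow> (real ^ 'n) \<Rightarrow>\<^sub>L (real ^ 'n)"
    where g: "\<And>x. GDERIV \<Phi> x :> g x"
      and H: "\<And>x. (g has_derivative blinfun_apply (H x)) (at x)" "continuous_on UNIV H"
    using C2_potential unfolding C2_def by blast
  have gg: "gradient \<Phi> = g" using gradient_eqI[OF g] by auto
  have "compact (H ` cball 0 R)"
    using H(2) continuous_on_subset by (intro compact_continuous_image) auto
  from compact_imp_bounded[OF this] obtain B where B: "B > 0" "\<And>x. x \<in> cball 0 R \<Longrightarrow> norm (H x) \<le> B"
    unfolding bounded_pos by blast
  have "norm (g x - g y) \<le> B * norm (x - y)" if "x \<in> cball 0 R" "y \<in> cball 0 R" for x y
  proof (rule differentiable_bound[where S = "cball 0 R" and f' = "\<lambda>x. blinfun_apply (H x)"])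
    show "(g has_derivative blinfun_apply (H x)) (at x within cball 0 R)" for x
      using H(1) by (rule has_derivative_at_withinI)
    show "onorm (blinfun_apply (H x)) \<le> B" if "x \<in> cball 0 R" for x
      using B(2)[OF that] by (simp add: norm_blinfun.rep_eq)
  qed (use that in auto)
  then show ?thesis
    using B(1) unfolding gg by (intro exI[of _ B] lipschitz_onI) (auto simp: dist_norm)
qed

text \<open>Only the position has to be bounded, since the momentum enters the field linearly.\<close>

lemma field_lipschitz: "\<exists>L. L-lipschitz_on {z. norm (fst z) \<le> R} field"
proof -
  obtain L where L: "L-lipschitz_on (cball 0 R) (gradient \<Phi>)" using gradient_lipschitz by blast
  have L0: "L \<ge> 0" using L by (rule lipschitz_on_nonneg)
  have "(1 + L)-lipschitz_on {z. norm (fst z) \<le> R} field"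
  proof (rule lipschitz_onI)
    fix x y :: "'n phase" assume xy: "x \<in> {z. norm (fst z) \<le> R}" "y \<in> {z. norm (fst z) \<le> R}"
    have "dist (field x) (field y)
        = norm (snd x - snd y, - (gradient \<Phi> (fst x) - gradient \<Phi> (fst y)))"
      by (simp add: field_def dist_norm)
    also have "\<dots> \<le> dist (snd x) (snd y) + dist (gradient \<Phi> (fst x)) (gradient \<Phi> (fst y))"
      using norm_Pair_le by (metis dist_norm norm_minus_cancel)
    also have "\<dots> \<le> dist (snd x) (snd y) + L * dist (fst x) (fst y)"
      using lipschitz_onD[OF L, of "fst x" "fst y"] xy by simp
    also have "\<dots> \<le> dist x y + L * dist x y"
      using L0 by (intro add_mono mult_left_mono dist_fst_le dist_snd_le)
    finally show "dist (field x) (field y) \<le> (1 + L) * dist x y" by (simp add: algebra_simps)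
  qed (use L0 in simp)
  then show ?thesis by blast
qed

lemma energy_conserved:
  assumes "motion_until t x"
  shows "energy (x t) = energy (x 0)"
proof -
  have "\<exists>c. \<forall>s\<in>closed_segment 0 t. energy (x s) = c"
  proof (rule has_derivative_zero_constant)
    fix s assume "s \<in> closed_segment 0 t"
    then have x: "(x has_derivative (\<lambda>h. h *\<^sub>R field (x s))) (at s)"
      using assms by (simp add: motion_until_def has_vector_derivative_def)
    have q: "((\<lambda>s. fst (x s)) has_derivative (\<lambda>h. h *\<^sub>R snd (x s))) (at s)"
      using has_derivative_fst[OF x] by (simp add: field_def)
    have p: "((\<lambda>s. snd (x s)) has_derivative (\<lambda>h. h *\<^sub>R - gradient \<Phi> (fst (x s)))) (at s)"
      using has_derivative_snd[OF x] by (simp add: field_def)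
    have "((\<lambda>s. (snd (x s) \<bullet> snd (x s)) / 2 + \<Phi> (fst (x s))) has_derivative (\<lambda>h. 0)) (at s)"
      by (rule has_derivative_eq_rhs, rule has_derivative_add[OF
          bounded_linear.has_derivative[OF bounded_linear_divide has_derivative_inner[OF p p]]
          has_derivative_compose[OF q potential_has_derivative]])
        (auto simp: inner_commute)
    then show "((\<lambda>s. energy (x s)) has_derivative (\<lambda>h. 0)) (at s within closed_segment 0 t)"
      unfolding energy_def power2_norm_eq_inner by (rule has_derivative_at_withinI)
  qed auto
  then show ?thesis by auto
qed

lemma motion_until_mono: "motion_until t x \<Longrightarrow> s \<in> closed_segment 0 t \<Longrightarrow> motion_until s x"
  unfolding motion_until_def by (auto simp: closed_segment_eq_real_ivl split: if_splits)

lemma momentum_bound: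
  assumes "motion_until t x"
  shows "norm (snd (x t)) \<le> speed_bound (x 0)"
proof -
  have "(norm (snd (x t)))\<^sup>2 \<le> 2 * energy (x t)" using potential_nonneg by (simp add: energy_def)
  also have "\<dots> = (norm (snd (x 0)))\<^sup>2 + 2 * \<Phi> (fst (x 0))"
    unfolding energy_conserved[OF assms] by (simp add: energy_def)
  finally have "norm (snd (x t)) \<le> sqrt ((norm (snd (x 0)))\<^sup>2 + 2 * \<Phi> (fst (x 0)))"
    by (rule real_le_rsqrt)
  also have "\<dots> \<le> sqrt ((norm (snd (x 0)))\<^sup>2) + sqrt (2 * \<Phi> (fst (x 0)))"
    using potential_nonneg by (intro sqrt_add_le_add_sqrt) auto
  finally show ?thesis by (simp add: speed_bound_def)
qed

lemma position_has_derivative: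
  assumes "motion_until t x" "s \<in> closed_segment 0 t"
  shows "((\<lambda>s. fst (x s)) has_vector_derivative snd (x s)) (at s)"
    "((\<lambda>s. snd (x s)) has_vector_derivative - gradient \<Phi> (fst (x s))) (at s)"
proof -
  have x: "(x has_derivative (\<lambda>h. h *\<^sub>R field (x s))) (at s)"
    using assms by (simp add: motion_until_def has_vector_derivative_def)
  show "((\<lambda>s. fst (x s)) has_vector_derivative snd (x s)) (at s)"
    using has_derivative_fst[OF x] by (simp add: field_def has_vector_derivative_def)
  show "((\<lambda>s. snd (x s)) has_vector_derivative - gradient \<Phi> (fst (x s))) (at s)"
    using has_derivative_snd[OF x] by (simp add: field_def has_vector_derivative_def)
qed

text \<open>Positions stay bounded on bounded time intervals without any growth condition on the potential.
  This excludes blow-up.\<close>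

lemma displacement_bound:
  assumes x: "motion_until t x"
  shows "norm (fst (x t) - fst (x 0)) \<le> \<bar>t\<bar> * speed_bound (x 0)"
proof -
  have "norm (fst (x t) - fst (x 0)) \<le> speed_bound (x 0) * norm (t - 0)"
  proof (rule differentiable_bound[where S = "closed_segment 0 t" and f' = "\<lambda>s h. h *\<^sub>R snd (x s)"])
    fix s assume s: "s \<in> closed_segment 0 t"
    show "((\<lambda>s. fst (x s)) has_derivative (\<lambda>h. h *\<^sub>R snd (x s))) (at s within closed_segment 0 t)"
      using position_has_derivative(1)[OF x s] has_derivative_at_withinI
      by (auto simp: has_vector_derivative_def)
    show "onorm (\<lambda>h. h *\<^sub>R snd (x s)) \<le> speed_bound (x 0)"
      using momentum_bound[OF motion_until_mono[OF x s]]
      by (intro onorm_le) (auto simp: mult.commute[of "\<bar>_\<bar>"] intro: mult_right_mono)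
  qed auto
  then show ?thesis by (simp add: mult.commute)
qed

text \<open>The contribution of the potential to \<open>speed_bound\<close> is bounded over bounded sets of initial
  positions.\<close>

lemma potential_speed_bounded: "\<exists>V\<ge>0. \<forall>q. norm q \<le> R \<longrightarrow> sqrt (2 * \<Phi> q) \<le> V"
proof -
  have "compact (\<Phi> ` cball 0 R)"
    by (intro compact_continuous_image potential_continuous compact_cball)
  from compact_imp_bounded[OF this] obtain B where B: "B > 0" "\<And>q. q \<in> cball 0 R \<Longrightarrow> norm (\<Phi> q) \<le> B"
    unfolding bounded_pos by blast
  have "sqrt (2 * \<Phi> q) \<le> sqrt (2 * B)" if "norm q \<le> R" for q
    using B(2)[of q] that by simp
  then show ?thesis using B(1) by (intro exI[of _ "sqrt (2 * B)"]) auto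
qed

lemma motion_bounded:
  assumes "motion_until t x" "norm (x 0) \<le> R" "\<bar>t\<bar> \<le> T" "\<And>q. norm q \<le> R \<Longrightarrow> sqrt (2 * \<Phi> q) \<le> V"
  shows "norm (fst (x t)) \<le> R + T * (R + V)" "norm (snd (x t)) \<le> R + V"
proof -
  have *: "norm (fst (x 0)) \<le> R" "norm (snd (x 0)) \<le> R"
    using assms(2) norm_fst_le[of "fst (x 0)" "snd (x 0)"] norm_snd_le[of "snd (x 0)" "fst (x 0)"] by auto
  then have v: "speed_bound (x 0) \<le> R + V"
    unfolding speed_bound_def by (intro add_mono assms(4))
  have v0: "0 \<le> speed_bound (x 0)" using potential_nonneg by (simp add: speed_bound_def)
  show "norm (snd (x t)) \<le> R + V" using momentum_bound[OF assms(1)] v by simp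
  have "norm (fst (x t)) \<le> norm (fst (x 0)) + norm (fst (x t) - fst (x 0))"
    using norm_triangle_ineq[of "fst (x 0)" "fst (x t) - fst (x 0)"] by simp
  also have "\<dots> \<le> R + T * (R + V)"
  proof (rule add_mono[OF *(1)])
    have "norm (fst (x t) - fst (x 0)) \<le> \<bar>t\<bar> * speed_bound (x 0)"
      by (rule displacement_bound[OF assms(1)])
    also have "\<dots> \<le> T * (R + V)" using v v0 assms(3) by (intro mult_mono) auto
    finally show "norm (fst (x t) - fst (x 0)) \<le> T * (R + V)" .
  qed
  finally show "norm (fst (x t)) \<le> R + T * (R + V)" .
qed

lemma motion_lipschitz:
  "\<exists>L. \<forall>t x y. \<bar>t\<bar> \<le> T \<longrightarrow> motion_until t x \<longrightarrow> motion_until t y \<longrightarrow> norm (x 0) \<le> R \<longrightarrow> norm (y 0) \<le> R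
     \<longrightarrow> dist (x t) (y t) \<le> L * dist (x 0) (y 0)"
proof -
  obtain V where V: "\<And>q. norm q \<le> R \<Longrightarrow> sqrt (2 * \<Phi> q) \<le> V" using potential_speed_bounded by metis
  obtain L where L: "L-lipschitz_on {z. norm (fst z) \<le> R + T * (R + V)} field"
    using field_lipschitz by blast
  show ?thesis
  proof (intro exI[of _ "exp (L * T)"] allI impI)
    fix t x y assume *: "\<bar>t\<bar> \<le> T" "motion_until t x" "motion_until t y" "norm (x 0) \<le> R" "norm (y 0) \<le> R"
    have "dist (x t) (y t) \<le> exp (L * \<bar>t\<bar>) * dist (x 0) (y 0)"
    proof (rule gronwall[OF L])
      fix s assume s: "s \<in> closed_segment 0 t"
      show "(x has_vector_derivative field (x s)) (at s)" "(y has_vector_derivative field (y s)) (at s)"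
        using * s by (auto simp: motion_until_def)
      have "\<bar>s\<bar> \<le> T" using s *(1) by (auto simp: closed_segment_eq_real_ivl split: if_splits)
      then show "x s \<in> {z. norm (fst z) \<le> R + T * (R + V)} \<and> y s \<in> {z. norm (fst z) \<le> R + T * (R + V)}"
        using motion_bounded(1)[OF motion_until_mono[OF *(2) s] *(4) _ V]
          motion_bounded(1)[OF motion_until_mono[OF *(3) s] *(5) _ V] by blast
    qed
    also have "\<dots> \<le> exp (L * T) * dist (x 0) (y 0)"
      using *(1) lipschitz_on_nonneg[OF L] by (intro mult_right_mono) (auto intro: mult_left_mono)
    finally show "dist (x t) (y t) \<le> exp (L * T) * dist (x 0) (y 0)" .
  qed
qed

lemma motion_unique:
  assumes "motion_until t x" "motion_until t y" "x 0 = y 0"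
  shows "x t = y t"
proof -
  obtain L where L: "\<forall>s u v. \<bar>s\<bar> \<le> \<bar>t\<bar> \<longrightarrow> motion_until s u \<longrightarrow> motion_until s v \<longrightarrow>
      norm (u 0) \<le> norm (y 0) \<longrightarrow> norm (v 0) \<le> norm (y 0) \<longrightarrow> dist (u s) (v s) \<le> L * dist (u 0) (v 0)"
    using motion_lipschitz by blast
  have "dist (x t) (y t) \<le> L * dist (x 0) (y 0)"
    using L[rule_format, of t x y] assms by simp
  then show ?thesis using assms(3) by simp
qed

text \<open>The force outside of the ball of radius \<open>R\<close> is replaced by the one at the nearest point of the ball.
  The metric projection onto the ball is nonexpansive, so the result is globally Lipschitz. It is no
  longer a gradient field, and energy is conserved only as long as the position stays in the ball.\<close>

definition truncated_field :: "real \<Rightarrow> 'n phase \<Rightarrow> 'n phase" where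
  "truncated_field R z = field (closest_point (cball 0 R) (fst z), snd z)"

lemma truncated_field_eq: "norm (fst z) \<le> R \<Longrightarrow> truncated_field R z = field z"
  by (simp add: truncated_field_def closest_point_self)

lemma truncated_field_lipschitz:
  assumes "0 \<le> R"
  shows "\<exists>L. L-lipschitz_on UNIV (truncated_field R)"
proof -
  obtain L where L: "L-lipschitz_on {z. norm (fst z) \<le> R} field" using field_lipschitz by blast
  have "L-lipschitz_on UNIV (truncated_field R)"
  proof (rule lipschitz_onI)
    fix x y :: "'n phase"
    let ?c = "\<lambda>z::'n phase. (closest_point (cball 0 R) (fst z), snd z)"
    have mem: "?c z \<in> {z. norm (fst z) \<le> R}" for z
      using closest_point_in_set[of "cball 0 R" "fst z"] assms by simp
    have "dist (truncated_field R x) (truncated_field R y) \<le> L * dist (?c x) (?c y)"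
      unfolding truncated_field_def by (intro lipschitz_onD[OF L] mem)
    also have "dist (?c x) (?c y) \<le> dist x y"
      unfolding dist_prod_def using closest_point_lipschitz[of "cball 0 R" "fst x" "fst y"] assms
      by (intro real_sqrt_le_mono add_mono power_mono) auto
    finally show "dist (truncated_field R x) (truncated_field R y) \<le> L * dist x y"
      using lipschitz_on_nonneg[OF L] by (simp add: mult_left_mono)
  qed (rule lipschitz_on_nonneg[OF L])
  then show ?thesis by blast
qed

lemma truncated_motion_until:
  assumes "\<And>t. (x has_vector_derivative truncated_field R (x t)) (at t)"
    and "\<And>s. s \<in> closed_segment 0 t \<Longrightarrow> norm (fst (x s)) \<le> R"
  shows "motion_until t x"
  using assms truncated_field_eq unfolding motion_until_def by metis

text \<open>Up to the first time at which the position has norm \<open>R\<close>, the curve solves the original equations and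
  \<open>displacement_bound\<close> applies, which shows that the norm at that time is still less than \<open>R\<close>.\<close>

lemma truncated_motion_stays_inside:
  assumes x: "\<And>t. (x has_vector_derivative truncated_field R (x t)) (at t)"
    and R: "norm (fst (x 0)) + T * speed_bound (x 0) < R" and t: "0 \<le> t" "t \<le> T"
  shows "norm (fst (x t)) < R"
proof (rule ccontr)
  assume "\<not> norm (fst (x t)) < R"
  define E where "E = {0..t} \<inter> {s. R \<le> norm (fst (x s))}"
  have cx: "continuous_on S x" for S
    using x by (meson has_vector_derivative_continuous continuous_at_imp_continuous_on)
  have "closed E" unfolding E_def
    by (intro closed_Int closed_Collect_le continuous_intros cx)
  then have "compact E" unfolding compact_eq_bounded_closed
    using bounded_subset[of "{0..t}" E] by (auto simp: E_def)
  moreover have "t \<in> E" using \<open>\<not> norm (fst (x t)) < R\<close> t by (auto simp: E_def)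
  ultimately obtain s where s: "s \<in> E" "\<And>s'. s' \<in> E \<Longrightarrow> s \<le> s'"
    using compact_attains_inf[of E] by blast
  have st: "0 \<le> s" "s \<le> t" "R \<le> norm (fst (x s))" using s(1) by (auto simp: E_def)
  have inside: "norm (fst (x s')) < R" if "0 \<le> s'" "s' < s" for s'
    using s(2)[of s'] that st by (force simp: E_def not_le)
  have v0: "0 \<le> speed_bound (x 0)" using potential_nonneg by (simp add: speed_bound_def)
  have "norm (fst (x 0)) < R" using R v0 t by (smt (verit) mult_nonneg_nonneg)
  then have "s \<noteq> 0" using st(3) by auto
  have "norm (fst (x s)) \<le> R"
  proof (rule tendsto_upperbound)
    show "((\<lambda>s. norm (fst (x s))) \<longlongrightarrow> norm (fst (x s))) (at_left s)"
      using x[of s, THEN has_vector_derivative_continuous]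
      by (intro tendsto_intros) (simp add: continuous_at tendsto_within_subset filterlim_at_split)
    show "\<forall>\<^sub>F s in at_left s. norm (fst (x s)) \<le> R"
      using eventually_at_left_real[of 0 s] \<open>s \<noteq> 0\<close> st(1) inside
      by (auto elim!: eventually_mono intro: less_imp_le)
  qed auto
  then have "norm (fst (x s')) \<le> R" if "0 \<le> s'" "s' \<le> s" for s'
    using inside that by (cases "s' = s") (auto intro: less_imp_le)
  then have "motion_until s x"
    using st(1) by (intro truncated_motion_until[OF x]) (simp add: closed_segment_eq_real_ivl)
  from displacement_bound[OF this] have "norm (fst (x s) - fst (x 0)) \<le> T * speed_bound (x 0)"
    using st t mult_right_mono[OF _ v0, of s T] by simp
  then show False using st(3) R norm_triangle_sub[of "fst (x s)" "fst (x 0)"] by simp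
qed

text \<open>Negative times are covered by time reversal: if \<open>(q t, p t)\<close> is a solution, then so is
  \<open>(q (- t), - p (- t))\<close>, for the truncated field as well.\<close>

lemma motion_exists_until:
  assumes "0 \<le> T"
  shows "\<exists>x. x 0 = z \<and> motion_until T x \<and> motion_until (- T) x"
proof -
  \<comment> \<open>Strictly larger than the norm of any position that energy conservation permits up to time \<open>T\<close>.\<close>
  define R where "R = norm (fst z) + T * speed_bound z + 1"
  have "0 \<le> speed_bound z" using potential_nonneg by (simp add: speed_bound_def)
  then have R: "0 \<le> R" "norm (fst z) + T * speed_bound z < R" using assms by (auto simp: R_def)
  obtain L where "L-lipschitz_on UNIV (truncated_field R)" using truncated_field_lipschitz[OF R(1)] by blast
  from global_solution_exists[OF this] obtain x
    where x: "x 0 = z" "\<And>t. (x has_vector_derivative truncated_field R (x t)) (at t)" by blast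
  define y where "y t = (fst (x (- t)), - snd (x (- t)))" for t
  have y: "(y has_vector_derivative truncated_field R (y t)) (at t)" for t
  proof -
    have d: "((\<lambda>t. x (- t)) has_derivative (\<lambda>h. h *\<^sub>R - truncated_field R (x (- t)))) (at t)"
      using has_vector_derivative_reflect[OF x(2), of t] by (simp add: has_vector_derivative_def)
    show ?thesis unfolding y_def has_vector_derivative_def
      by (rule has_derivative_eq_rhs,
          rule has_derivative_Pair[OF has_derivative_fst[OF d] has_derivative_minus[OF has_derivative_snd[OF d]]])
         (auto simp: truncated_field_def field_def)
  qed
  have "norm (fst (x t)) < R" if "\<bar>t\<bar> \<le> T" for t
  proof (cases "0 \<le> t")
    case True
    then show ?thesis using truncated_motion_stays_inside[OF x(2), of T t] that R x(1) by simp
  next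
    case False
    have "norm (fst (y (- t))) < R"
      by (rule truncated_motion_stays_inside[OF y, of T])
         (use False that R x(1) in \<open>auto simp: y_def speed_bound_def\<close>)
    then show ?thesis by (simp add: y_def)
  qed
  then have "motion_until t x" if "\<bar>t\<bar> \<le> T" for t
    using that by (intro truncated_motion_until[OF x(2)] less_imp_le)
      (auto simp: closed_segment_eq_real_ivl split: if_splits)
  with x(1) assms show ?thesis by (intro exI[of _ x]) auto
qed

text \<open>The solutions on the intervals \<open>[- n, n]\<close> extend each other by uniqueness.\<close>

lemma motion_exists: "\<exists>x. x 0 = z \<and> (\<forall>t. (x has_vector_derivative field (x t)) (at t))"
proof -
  have "\<forall>n::nat. \<exists>x. x 0 = z \<and> motion_until n x \<and> motion_until (- n) x"
    using motion_exists_until by simp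
  then obtain X where X: "\<And>n. X n 0 = z" "\<And>n. motion_until (real n) (X n)" "\<And>n. motion_until (- real n) (X n)"
    by metis
  have X_motion: "motion_until t (X n)" if "\<bar>t\<bar> \<le> n" for t n
    using motion_until_mono[OF X(2), of t n] motion_until_mono[OF X(3), of t n] that
    by (cases "0 \<le> t") (auto simp: closed_segment_eq_real_ivl)
  \<comment> \<open>\<open>N t\<close> is some natural number beyond \<open>|t|\<close>.\<close>
  define N where "N t = nat \<lceil>\<bar>t\<bar>\<rceil> + 1" for t :: real
  have N: "\<bar>t\<bar> < N t" for t unfolding N_def by linarith
  define x where "x t = X (N t) t" for t
  have eq: "x t = X n t" if "\<bar>t\<bar> < n" for n t
    unfolding x_def by (rule motion_unique[OF X_motion X_motion]) (use that N[of t] X(1) in auto)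
  have "(x has_vector_derivative field (x t)) (at t)" for t
  proof (rule has_vector_derivative_transform_within_open[where S = "{- real (N t)<..<real (N t)}"])
    show "(X (N t) has_vector_derivative field (x t)) (at t)"
      using X_motion[of t "N t"] N[of t] unfolding x_def motion_until_def by auto
    show "X (N t) s = x s" if "s \<in> {- real (N t)<..<real (N t)}" for s
      using that by (intro eq[symmetric]) auto
  qed (use N[of t] in auto)
  moreover have "x 0 = z" by (simp add: x_def X(1))
  ultimately show ?thesis by blast
qed

section \<open>The Hamiltonian flow\<close>

abbreviation flow :: "real \<Rightarrow> 'n phase \<Rightarrow> 'n phase" where
  "flow \<equiv> hamiltonian_flow \<Phi>"

lemma hamiltonian_flow_unique_exists: "\<exists>!\<theta>. is_hamiltonian_flow \<Phi> \<theta>"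
proof (rule ex_ex1I)
  obtain x where x: "\<And>z. x z 0 = z" "\<And>z t. (x z has_vector_derivative field (x z t)) (at t)"
    using motion_exists by metis
  then have "is_hamiltonian_flow \<Phi> (\<lambda>t z. x z t)"
    unfolding is_hamiltonian_flow_def by (simp add: field_def[symmetric])
  then show "\<exists>\<theta>. is_hamiltonian_flow \<Phi> \<theta>" by blast
next
  fix \<theta> \<theta>' assume \<theta>: "is_hamiltonian_flow \<Phi> \<theta>" "is_hamiltonian_flow \<Phi> \<theta>'"
  have "\<theta> t z = \<theta>' t z" for t z
    using \<theta> by (intro motion_unique[of t "\<lambda>t. \<theta> t z" "\<lambda>t. \<theta>' t z"])
      (simp_all add: is_hamiltonian_flow_def motion_until_def field_def del: split_paired_All)
  then show "\<theta> = \<theta>'" by blast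
qed

lemma is_flow: "is_hamiltonian_flow \<Phi> flow"
  unfolding hamiltonian_flow_def by (rule theI'[OF hamiltonian_flow_unique_exists])

lemma flow_0 [simp]: "flow 0 z = z"
  using is_flow by (simp add: is_hamiltonian_flow_def del: split_paired_All)

lemma flow_has_derivative: "((\<lambda>s. flow s z) has_vector_derivative field (flow t z)) (at t)"
  using is_flow by (simp add: is_hamiltonian_flow_def field_def del: split_paired_All)

lemma flow_motion: "motion_until t (\<lambda>s. flow s z)"
  unfolding motion_until_def using flow_has_derivative by blast

text \<open>The instance of the group law that allows to flow backwards from a target.\<close>

lemma flow_inverse: "flow r (flow (- r) z) = z"
proof -
  have "((\<lambda>s. flow (s - r) z) has_vector_derivative field (flow (t - r) z)) (at t)" for t
  proof -
    have "((\<lambda>s. s - r) has_vector_derivative 1) (at t)"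
      by (auto intro!: derivative_eq_intros)
    from vector_diff_chain_at[OF this, of "\<lambda>s. flow s z"] flow_has_derivative
    show ?thesis by (simp add: o_def)
  qed
  then have "motion_until r (\<lambda>s. flow (s - r) z)" by (simp add: motion_until_def)
  from motion_unique[OF flow_motion this, of "flow (- r) z"] show ?thesis by simp
qed

lemma flow_lipschitz: "\<exists>L. \<forall>t. \<bar>t\<bar> \<le> T \<longrightarrow> L-lipschitz_on (cball 0 R) (flow t)"
proof -
  obtain L where L: "\<forall>t x y. \<bar>t\<bar> \<le> T \<longrightarrow> motion_until t x \<longrightarrow> motion_until t y \<longrightarrow> norm (x 0) \<le> R \<longrightarrow>
      norm (y 0) \<le> R \<longrightarrow> dist (x t) (y t) \<le> L * dist (x 0) (y 0)"
    using motion_lipschitz by blast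
  have "\<bar>L\<bar>-lipschitz_on (cball 0 R) (flow t)" if t: "\<bar>t\<bar> \<le> T" for t
  proof (rule lipschitz_onI)
    fix x y :: "'n phase" assume xy: "x \<in> cball 0 R" "y \<in> cball 0 R"
    have "dist (flow t x) (flow t y) \<le> L * dist x y"
      using L[rule_format, OF t flow_motion flow_motion, of x y] xy by simp
    also have "\<dots> \<le> \<bar>L\<bar> * dist x y" by (intro mult_right_mono) auto
    finally show "dist (flow t x) (flow t y) \<le> \<bar>L\<bar> * dist x y" .
  qed simp
  then show ?thesis by blast
qed

lemma flow_bounded: "\<exists>M\<ge>0. \<forall>t z. \<bar>t\<bar> \<le> T \<longrightarrow> norm z \<le> R \<longrightarrow> norm (flow t z) \<le> M"
proof -
  obtain V where V: "\<And>q. norm q \<le> R \<Longrightarrow> sqrt (2 * \<Phi> q) \<le> V" using potential_speed_bounded by metis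
  define M where "M = (R + T * (R + V)) + (R + V)"
  have M: "norm (flow t z) \<le> M" if "\<bar>t\<bar> \<le> T" "norm z \<le> R" for t z
  proof -
    have "norm (flow t z) \<le> norm (fst (flow t z)) + norm (snd (flow t z))"
      using norm_Pair_le[of "fst (flow t z)" "snd (flow t z)"] by simp
    then show ?thesis
      using motion_bounded[OF flow_motion[of t z] _ that(1) V] that(2) by (fastforce simp: M_def)
  qed
  have "norm (flow t z) \<le> max 0 M" if "\<bar>t\<bar> \<le> T" "norm z \<le> R" for t z
    using M[OF that] by simp
  then show ?thesis by (intro exI[of _ "max 0 M"]) auto
qed

text \<open>Joint continuity: the flow is continuous in time for each state, and Lipschitz in the state locally
  uniformly in time.\<close>

lemma flow_continuous: "continuous_on UNIV (\<lambda>tz. flow (fst tz) (snd tz))"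
proof (rule continuous_at_imp_continuous_on, rule ballI)
  fix tz :: "real \<times> 'n phase"
  obtain t z where tz: "tz = (t, z)" by (cases tz)
  obtain L where L: "\<And>s. \<bar>s\<bar> \<le> \<bar>t\<bar> + 1 \<Longrightarrow> L-lipschitz_on (cball 0 (norm z + 1)) (flow s)"
    using flow_lipschitz by metis
  have "((\<lambda>u. L * dist (snd u) z + dist (flow (fst u) z) (flow t z)) \<longlongrightarrow> L * dist (snd tz) z + dist (flow t z) (flow t z)) (at tz)"
  proof (intro tendsto_intros)
    have "isCont (\<lambda>s. flow s z) (fst tz)"
      unfolding tz fst_conv by (rule has_vector_derivative_continuous[OF flow_has_derivative])
    then have "isCont (\<lambda>u. flow (fst u) z) tz"
      by (intro continuous_at_compose[unfolded o_def, of tz fst "\<lambda>s. flow s z"] continuous_intros) auto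
    then show "((\<lambda>u. flow (fst u) z) \<longlongrightarrow> flow t z) (at tz)"
      by (simp add: isCont_def tz)
  qed
  then have lim: "((\<lambda>u. L * dist (snd u) z + dist (flow (fst u) z) (flow t z)) \<longlongrightarrow> 0) (at tz)"
    by (simp add: tz)
  have "((\<lambda>u. flow (fst u) (snd u)) \<longlongrightarrow> flow t z) (at tz)"
  proof (rule tendstoI)
    fix e :: real assume "0 < e"
    have "\<forall>\<^sub>F u in at tz. u \<in> ball tz 1" by (rule eventually_at_in_open') auto
    moreover have "\<forall>\<^sub>F u in at tz. L * dist (snd u) z + dist (flow (fst u) z) (flow t z) < e"
      using order_tendstoD(2)[OF lim \<open>0 < e\<close>] .
    ultimately show "\<forall>\<^sub>F u in at tz. dist (flow (fst u) (snd u)) (flow t z) < e"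
    proof eventually_elim
      fix u :: "real \<times> 'n phase"
      assume u: "u \<in> ball tz 1" "L * dist (snd u) z + dist (flow (fst u) z) (flow t z) < e"
      have 1: "dist (fst u) t \<le> 1" "dist (snd u) z \<le> 1"
        using u(1) dist_fst_le[of u tz] dist_snd_le[of u tz] by (auto simp: tz dist_commute)
      have "\<bar>fst u\<bar> \<le> \<bar>t\<bar> + 1" using 1(1) by (simp add: dist_real_def)
      moreover have "norm (snd u) \<le> norm z + 1"
        using 1(2) norm_triangle_sub[of "snd u" z] by (simp add: dist_norm)
      ultimately have "dist (flow (fst u) (snd u)) (flow (fst u) z) \<le> L * dist (snd u) z"
        by (intro lipschitz_onD[OF L]) auto
      then show "dist (flow (fst u) (snd u)) (flow t z) < e"
        using u(2) dist_triangle[of "flow (fst u) (snd u)" "flow t z" "flow (fst u) z"] by simp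
    qed
  qed
  then show "isCont (\<lambda>tz. flow (fst tz) (snd tz)) tz" by (simp add: isCont_def tz)
qed

lemma flow_continuous_on [continuous_intros]:
  assumes "continuous_on S f" "continuous_on S g"
  shows "continuous_on S (\<lambda>x. flow (f x) (g x))"
  using continuous_on_compose2[OF flow_continuous continuous_on_Pair[OF assms]] by simp

lemma flow_measurable [measurable (raw)]:
  assumes "f \<in> borel_measurable M" "g \<in> borel_measurable M"
  shows "(\<lambda>x. flow (f x) (g x)) \<in> borel_measurable M"
proof -
  have "(\<lambda>tz. flow (fst tz) (snd tz)) \<in> borel_measurable borel"
    by (rule borel_measurable_continuous_onI[OF flow_continuous])
  from measurable_compose[OF borel_measurable_Pair[OF assms] this] show ?thesis by simp
qed

text \<open>For small \<open>s\<close>, a motion that starts in \<open>q\<close> with momentum \<open>p\<close> of norm at most \<open>m = 2 R / s + 1\<close> stays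
  in a ball whose radius does not depend on \<open>s\<close>. The force is bounded there, so at time \<open>s\<close> the
  position differs from \<open>q + s p\<close> by at most \<open>s\<close>. Hence the map that corrects the momentum by the
  remaining distance to the target divided by \<open>s\<close> sends the ball of radius \<open>m\<close> into itself, and a
  fixed point of it is a momentum that reaches the target.\<close>

lemma shooting:
  assumes R: "0 \<le> R"
  shows "\<exists>\<tau> M. 0 < \<tau> \<and> \<tau> \<le> 1 / 2 \<and> (\<forall>s q q'. \<tau> / 2 \<le> s \<longrightarrow> s \<le> \<tau> \<longrightarrow> norm q \<le> R \<longrightarrow> norm q' \<le> R \<longrightarrow>
           (\<exists>p. norm p \<le> M \<and> fst (flow s (q, p)) = q'))"
proof -
  obtain V where V: "0 \<le> V" "\<And>q. norm q \<le> R \<Longrightarrow> sqrt (2 * \<Phi> q) \<le> V" using potential_speed_bounded by metis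
  \<comment> \<open>In time \<open>s \<le> 1\<close> a motion with initial momentum at most \<open>2 R / s + 1\<close> moves at most \<open>2 R + 1 + V\<close> away from its start, which has norm at most \<open>R\<close>.\<close>
  define R' where "R' = 3 * R + 1 + V"
  obtain L where L: "L-lipschitz_on (cball 0 R') (gradient \<Phi>)" using gradient_lipschitz by blast
  have "compact (gradient \<Phi> ` cball 0 R')"
    by (intro compact_continuous_image lipschitz_on_continuous_on[OF L] compact_cball)
  from compact_imp_bounded[OF this] obtain B where B: "B > 0" "\<And>q. q \<in> cball 0 R' \<Longrightarrow> norm (gradient \<Phi> q) \<le> B"
    unfolding bounded_pos by blast
  \<comment> \<open>With \<open>\<tau> B \<le> 1\<close> the momentum changes by at most \<open>1\<close>; with \<open>\<tau> \<le> 1 / 2\<close> all times up to \<open>2 \<tau>\<close> are at most \<open>1\<close>.\<close>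
  define \<tau> where "\<tau> = min (1 / 2) (1 / B)"
  have \<tau>: "0 < \<tau>" "\<tau> \<le> 1 / 2" "\<tau> * B \<le> 1"
    using B(1) by (auto simp: \<tau>_def min_def field_simps)
  have "\<exists>p. norm p \<le> 4 * R / \<tau> + 1 \<and> fst (flow s (q, p)) = q'"
    if s: "\<tau> / 2 \<le> s" "s \<le> \<tau>" and q: "norm q \<le> R" "norm q' \<le> R" for s q q'
  proof -
    have s0: "0 < s" "s \<le> 1" "s * B \<le> 1" using s \<tau> B(1) order_trans[OF mult_right_mono[OF s(2), of B] \<tau>(3)] by auto
    define m where "m = 2 * R / s + 1"
    have m: "m > 0" using R s0 by (simp add: m_def add_nonneg_pos)
    have straight: "norm (fst (flow s (q, p)) - q - s *\<^sub>R p) \<le> s" if p: "norm p \<le> m" for p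
    proof -
      let ?x = "\<lambda>u. flow u (q, p)"
      have inside: "norm (fst (?x u)) \<le> R'" if u: "0 \<le> u" "u \<le> s" for u
      proof -
        have "norm (fst (?x u) - q) \<le> u * (norm p + sqrt (2 * \<Phi> q))"
          using displacement_bound[OF flow_motion, of u "(q, p)"] u by (simp add: speed_bound_def)
        also have "\<dots> \<le> s * (m + V)"
          using u p V q potential_nonneg m by (intro mult_mono add_mono) auto
        also have "\<dots> = 2 * R + s * (1 + V)" using s0 by (simp add: m_def field_simps)
        also have "\<dots> \<le> 2 * R + 1 * (1 + V)" using s0 V by (intro add_left_mono mult_right_mono) auto
        finally show ?thesis
          using q(1) norm_triangle_sub[of "fst (?x u)" q] by (simp add: R'_def)
      qed
      have change: "norm (snd (?x u) - p) \<le> s * B" if u: "0 \<le> u" "u \<le> s" for u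
      proof -
        have "norm (snd (?x u) - snd (?x 0)) \<le> B * norm (u - 0)"
        proof (rule differentiable_bound[where S = "{0..s}"
              and f' = "\<lambda>v h. h *\<^sub>R - gradient \<Phi> (fst (?x v))"])
          fix v assume v: "v \<in> {0..s}"
          show "((\<lambda>v. snd (?x v)) has_derivative (\<lambda>h. h *\<^sub>R - gradient \<Phi> (fst (?x v)))) (at v within {0..s})"
            using position_has_derivative(2)[OF flow_motion, of v v "(q, p)"] has_derivative_at_withinI
            unfolding has_vector_derivative_def by auto
          have "norm (gradient \<Phi> (fst (?x v))) \<le> B" using inside v by (intro B) auto
          then show "onorm (\<lambda>h. h *\<^sub>R - gradient \<Phi> (fst (?x v))) \<le> B"
            by (intro onorm_le) (auto simp: mult.commute[of "\<bar>_\<bar>"] intro: mult_right_mono)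
        qed (use u in auto)
        also have "\<dots> \<le> B * s" using u B(1) by (intro mult_left_mono) auto
        finally show ?thesis by (simp add: mult.commute)
      qed
      have "norm (fst (?x s) - fst (?x 0) - (s - 0) *\<^sub>R snd (?x 0)) \<le> norm (s - 0) * (s * B)"
      proof (rule vector_differentiable_bound_linearization[where S = "{0..s}" and f' = "\<lambda>u. snd (?x u)"])
        show "((\<lambda>u. fst (?x u)) has_vector_derivative snd (?x u)) (at u within {0..s})" for u
          using position_has_derivative(1)[OF flow_motion, of u u "(q, p)"]
          by (auto intro: has_vector_derivative_at_within)
      qed (use s0 change in \<open>auto simp: closed_segment_eq_real_ivl\<close>)
      also have "\<dots> \<le> s" using s0 mult_left_mono[of "s * B" 1 s] by simp
      finally show ?thesis by simp
    qed
    define h where "h p = p + (1 / s) *\<^sub>R (q' - fst (flow s (q, p)))" for p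
    have "h \<in> cball 0 m \<rightarrow> cball 0 m"
    proof
      fix p :: "real ^ 'n" assume "p \<in> cball 0 m"
      then have *: "norm (fst (flow s (q, p)) - q - s *\<^sub>R p) \<le> s" using straight by simp
      have "h p = (1 / s) *\<^sub>R ((q' - q) - (fst (flow s (q, p)) - q - s *\<^sub>R p))"
        using s0 by (simp add: h_def algebra_simps)
      also have "norm \<dots> \<le> (1 / s) * ((R + R) + s)"
        unfolding norm_scaleR using s0 norm_triangle_ineq4[of "q' - q" "fst (flow s (q, p)) - q - s *\<^sub>R p"]
          norm_triangle_ineq4[of q' q] q * by (intro mult_mono) auto
      also have "\<dots> = m" using s0 by (simp add: m_def field_simps)
      finally show "h p \<in> cball 0 m" by simp
    qed
    moreover have "continuous_on (cball 0 m) h"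
      unfolding h_def by (intro continuous_intros)
    ultimately obtain p where p: "p \<in> cball 0 m" "h p = p" using brouwer_ball[OF m] by metis
    have "fst (flow s (q, p)) = q'" using p(2) s0 by (simp add: h_def)
    moreover have "m \<le> 4 * R / \<tau> + 1"
      using s \<tau>(1) R s0 by (simp add: m_def field_simps mult_left_mono)
    ultimately show ?thesis using p(1) by (intro exI[of _ p]) auto
  qed
  with \<tau>(1,2) show ?thesis by blast
qed

section \<open>Reachability by two jumps\<close>

text \<open>The state after waiting times \<open>s\<close> and \<open>s'\<close>, each of them ended by a jump, and a further time \<open>r\<close>
  without a jump, as a function of the pair \<open>\<xi>\<close> of the two Gaussian vectors.\<close>

abbreviation two_jumps ::
    "real \<Rightarrow> real \<Rightarrow> real \<Rightarrow> real \<Rightarrow> 'n phase \<Rightarrow> (real ^ 'n) \<times> (real ^ 'n) \<Rightarrow> 'n phase" where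
  "two_jumps \<phi> s s' r z \<xi> \<equiv> flow r (momentum_randomization \<phi> (snd \<xi>)
     (flow s' (momentum_randomization \<phi> (fst \<xi>) (flow s z))))"

lemma randomization_bound:
  "norm (momentum_randomization \<phi> \<xi> z) \<le> 2 * norm z + norm \<xi>"
proof -
  have "norm (momentum_randomization \<phi> \<xi> z) \<le> norm (fst z) + norm (cos \<phi> *\<^sub>R snd z + sin \<phi> *\<^sub>R \<xi>)"
    unfolding momentum_randomization_def by (rule norm_Pair_le)
  also have "norm (cos \<phi> *\<^sub>R snd z + sin \<phi> *\<^sub>R \<xi>) \<le> 1 * norm (snd z) + 1 * norm \<xi>"
    by (rule order_trans[OF norm_triangle_ineq])
      (unfold norm_scaleR, intro add_mono mult_right_mono, auto)
  finally show ?thesis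
    using norm_fst_le[of "fst z" "snd z"] norm_snd_le[of "snd z" "fst z"] by simp
qed

lemma randomization_lipschitz:
  "dist (momentum_randomization \<phi> \<xi> z) (momentum_randomization \<phi> \<xi>' z') \<le> 2 * dist z z' + dist \<xi> \<xi>'"
proof -
  have "momentum_randomization \<phi> \<xi> z - momentum_randomization \<phi> \<xi>' z'
      = momentum_randomization \<phi> (\<xi> - \<xi>') (z - z')"
    by (simp add: momentum_randomization_def algebra_simps)
  then show ?thesis using randomization_bound unfolding dist_norm by metis
qed

lemma two_jumps_lipschitz:
  "\<exists>L. \<forall>s s' r z. \<bar>s\<bar> \<le> T \<longrightarrow> \<bar>s'\<bar> \<le> T \<longrightarrow> \<bar>r\<bar> \<le> T \<longrightarrow> norm z \<le> R \<longrightarrow>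
     L-lipschitz_on (cball 0 M) (two_jumps \<phi> s s' r z)"
proof -
  obtain R1 where R1: "\<And>t z. \<bar>t\<bar> \<le> T \<Longrightarrow> norm z \<le> R \<Longrightarrow> norm (flow t z) \<le> R1"
    using flow_bounded by metis
  define R2 where "R2 = 2 * R1 + M"
  obtain R3 where R3: "\<And>t z. \<bar>t\<bar> \<le> T \<Longrightarrow> norm z \<le> R2 \<Longrightarrow> norm (flow t z) \<le> R3"
    using flow_bounded by metis
  define R4 where "R4 = 2 * R3 + M"
  obtain L2 where L2: "\<And>t. \<bar>t\<bar> \<le> T \<Longrightarrow> L2-lipschitz_on (cball 0 R2) (flow t)"
    using flow_lipschitz by metis
  obtain L4 where L4: "\<And>t. \<bar>t\<bar> \<le> T \<Longrightarrow> L4-lipschitz_on (cball 0 R4) (flow t)"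
    using flow_lipschitz by metis
  have "(L4 * (2 * L2 + 1))-lipschitz_on (cball 0 M) (two_jumps \<phi> s s' r z)"
    if *: "\<bar>s\<bar> \<le> T" "\<bar>s'\<bar> \<le> T" "\<bar>r\<bar> \<le> T" "norm z \<le> R" for s s' r z
  proof (rule lipschitz_onI)
    have L0: "0 \<le> L2" "0 \<le> L4" using L2[OF *(1)] L4[OF *(1)] lipschitz_on_nonneg by blast+
    then show "0 \<le> L4 * (2 * L2 + 1)" by simp
    fix \<xi> \<zeta> :: "(real ^ 'n) \<times> (real ^ 'n)" assume \<xi>: "\<xi> \<in> cball 0 M" "\<zeta> \<in> cball 0 M"
    let ?w = "\<lambda>\<xi> :: (real ^ 'n) \<times> (real ^ 'n). momentum_randomization \<phi> (fst \<xi>) (flow s z)"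
    let ?u = "\<lambda>\<xi> :: (real ^ 'n) \<times> (real ^ 'n). momentum_randomization \<phi> (snd \<xi>) (flow s' (?w \<xi>))"
    have small: "norm (fst \<xi>) \<le> M" "norm (snd \<xi>) \<le> M" if "\<xi> \<in> cball 0 M" for \<xi> :: "(real ^ 'n) \<times> (real ^ 'n)"
      using norm_fst_le[of "fst \<xi>" "snd \<xi>"] norm_snd_le[of "snd \<xi>" "fst \<xi>"] that by auto
    have w: "?w \<xi> \<in> cball 0 R2" if "\<xi> \<in> cball 0 M" for \<xi>
      using randomization_bound[of \<phi> "fst \<xi>" "flow s z"] R1[OF *(1,4)] small[OF that] by (simp add: R2_def)
    have u: "?u \<xi> \<in> cball 0 R4" if "\<xi> \<in> cball 0 M" for \<xi>
      using randomization_bound[of \<phi> "snd \<xi>" "flow s' (?w \<xi>)"] R3[OF *(2), of "?w \<xi>"] w[OF that] small[OF that]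
      by (simp add: R4_def)
    have "dist (?w \<xi>) (?w \<zeta>) \<le> dist (fst \<xi>) (fst \<zeta>)"
      using randomization_lipschitz[of \<phi> "fst \<xi>" "flow s z" "fst \<zeta>" "flow s z"] by simp
    also have "\<dots> \<le> dist \<xi> \<zeta>" by (rule dist_fst_le)
    finally have "L2 * dist (?w \<xi>) (?w \<zeta>) \<le> L2 * dist \<xi> \<zeta>" using L0 by (intro mult_left_mono)
    moreover have "dist (flow s' (?w \<xi>)) (flow s' (?w \<zeta>)) \<le> L2 * dist (?w \<xi>) (?w \<zeta>)"
      by (intro lipschitz_onD[OF L2] *(2) w \<xi>)
    moreover have "dist (?u \<xi>) (?u \<zeta>) \<le> 2 * dist (flow s' (?w \<xi>)) (flow s' (?w \<zeta>)) + dist (snd \<xi>) (snd \<zeta>)"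
      by (rule randomization_lipschitz)
    moreover have "dist (snd \<xi>) (snd \<zeta>) \<le> dist \<xi> \<zeta>" by (rule dist_snd_le)
    ultimately have "dist (?u \<xi>) (?u \<zeta>) \<le> 2 * (L2 * dist \<xi> \<zeta>) + dist \<xi> \<zeta>" by linarith
    then have "L4 * dist (?u \<xi>) (?u \<zeta>) \<le> L4 * (2 * (L2 * dist \<xi> \<zeta>) + dist \<xi> \<zeta>)"
      using L0 by (intro mult_left_mono)
    moreover have "dist (two_jumps \<phi> s s' r z \<xi>) (two_jumps \<phi> s s' r z \<zeta>) \<le> L4 * dist (?u \<xi>) (?u \<zeta>)"
      by (intro lipschitz_onD[OF L4] *(3) u \<xi>)
    ultimately show "dist (two_jumps \<phi> s s' r z \<xi>) (two_jumps \<phi> s s' r z \<zeta>) \<le> L4 * (2 * L2 + 1) * dist \<xi> \<zeta>"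
      by (simp add: algebra_simps)
  qed
  then show ?thesis by blast
qed

lemma randomization_onto:
  assumes "sin \<phi> > 0"
  shows "\<exists>\<xi>. norm \<xi> \<le> (norm p + norm (snd z)) / sin \<phi> \<and> momentum_randomization \<phi> \<xi> z = (fst z, p)"
proof (intro exI conjI)
  let ?\<xi> = "(1 / sin \<phi>) *\<^sub>R (p - cos \<phi> *\<^sub>R snd z)"
  have "norm (p - cos \<phi> *\<^sub>R snd z) \<le> norm p + norm (cos \<phi> *\<^sub>R snd z)" by (rule norm_triangle_ineq4)
  also have "norm (cos \<phi> *\<^sub>R snd z) \<le> norm (snd z)" by (simp add: mult_left_le_one_le)
  finally show "norm ?\<xi> \<le> (norm p + norm (snd z)) / sin \<phi>"
    using assms by (simp add: divide_right_mono)
  show "momentum_randomization \<phi> ?\<xi> z = (fst z, p)"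
    using assms by (simp add: momentum_randomization_def)
qed

text \<open>Backward from the target, the last piece of the motion determines the state right after the second
  jump; \<open>shooting\<close> supplies the momentum after the first jump that leads to the right position; both
  momenta are available because \<open>sin \<phi> > 0\<close>. All quantities involved are bounded uniformly in \<open>z\<close>,
  the target and the waiting times, which yields the radius \<open>M\<close>.\<close>

lemma two_jumps_onto:
  assumes sin: "sin \<phi> > 0"
  shows "\<exists>\<tau> M. 0 < \<tau> \<and> \<tau> \<le> 1 / 2 \<and> (\<forall>s s' r z. \<tau> / 2 \<le> s \<longrightarrow> s \<le> \<tau> \<longrightarrow> \<tau> / 2 \<le> s' \<longrightarrow> s' \<le> \<tau> \<longrightarrow> \<bar>r\<bar> \<le> 1 \<longrightarrow>
           norm z \<le> R \<longrightarrow> cball 0 R \<subseteq> two_jumps \<phi> s s' r z ` cball 0 M)"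
proof -
  obtain R1 where R1: "0 \<le> R1" "\<And>t z. \<bar>t\<bar> \<le> 1 \<Longrightarrow> norm z \<le> R \<Longrightarrow> norm (flow t z) \<le> R1"
    using flow_bounded by metis
  obtain \<tau> M where \<tau>: "0 < \<tau>" "\<tau> \<le> 1 / 2"
    and M: "\<And>s q q'. \<tau> / 2 \<le> s \<Longrightarrow> s \<le> \<tau> \<Longrightarrow> norm q \<le> R1 \<Longrightarrow> norm q' \<le> R1 \<Longrightarrow> \<exists>p. norm p \<le> M \<and> fst (flow s (q, p)) = q'"
    using shooting[OF R1(1)] by blast
  obtain R2 where R2: "\<And>t z. \<bar>t\<bar> \<le> 1 \<Longrightarrow> norm z \<le> R1 + M \<Longrightarrow> norm (flow t z) \<le> R2"
    using flow_bounded by metis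
  have nf: "norm (fst z) \<le> norm z" "norm (snd z) \<le> norm z" for z :: "'n phase"
    using norm_fst_le[of "fst z" "snd z"] norm_snd_le[of "snd z" "fst z"] by auto
  define N where "N = (M + R1) / sin \<phi> + (R1 + R2) / sin \<phi>"
  have "cball 0 R \<subseteq> two_jumps \<phi> s s' r z ` cball 0 N"
    if s: "\<tau> / 2 \<le> s" "s \<le> \<tau>" "\<tau> / 2 \<le> s'" "s' \<le> \<tau>" and r: "\<bar>r\<bar> \<le> 1" and z: "norm z \<le> R" for s s' r z
  proof
    fix y :: "'n phase" assume "y \<in> cball 0 R"
    then have y': "norm (flow (- r) y) \<le> R1" using R1(2)[of "- r" y] r by simp
    have z': "norm (flow s z) \<le> R1" using s \<tau> z by (intro R1(2)) auto
    obtain p where p: "norm p \<le> M" "fst (flow s' (fst (flow s z), p)) = fst (flow (- r) y)"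
      using M[OF s(3,4), of "fst (flow s z)" "fst (flow (- r) y)"]
        order_trans[OF nf(1) z'] order_trans[OF nf(1) y'] by blast
    obtain \<xi> where \<xi>: "norm \<xi> \<le> (norm p + norm (snd (flow s z))) / sin \<phi>"
      "momentum_randomization \<phi> \<xi> (flow s z) = (fst (flow s z), p)"
      using randomization_onto[OF sin] by blast
    let ?w = "flow s' (fst (flow s z), p)"
    obtain \<zeta> where \<zeta>: "norm \<zeta> \<le> (norm (snd (flow (- r) y)) + norm (snd ?w)) / sin \<phi>"
      "momentum_randomization \<phi> \<zeta> ?w = (fst ?w, snd (flow (- r) y))"
      using randomization_onto[OF sin] by blast
    have "norm (fst (flow s z), p) \<le> R1 + M"
      using norm_Pair_le[of "fst (flow s z)" p] order_trans[OF nf(1) z'] p(1) by simp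
    then have w: "norm ?w \<le> R2" using s \<tau> by (intro R2) auto
    have "norm (\<xi>, \<zeta>) \<le> norm \<xi> + norm \<zeta>" by (rule norm_Pair_le)
    also have "\<dots> \<le> N" unfolding N_def
      using sin p(1) nf(2) y' z' w
      by (intro add_mono order_trans[OF \<xi>(1)] order_trans[OF \<zeta>(1)] divide_right_mono)
        (auto intro: order_trans[OF nf(2)])
    finally have mem: "(\<xi>, \<zeta>) \<in> cball 0 N" by simp
    have hit: "two_jumps \<phi> s s' r z (\<xi>, \<zeta>) = y"
      using \<zeta>(2) p(2) by (simp add: \<xi>(2) flow_inverse)
    show "y \<in> two_jumps \<phi> s s' r z ` cball 0 N" 
      by (rule image_eqI[where x = "(\<xi>, \<zeta>)"]) (rule hit[symmetric], rule mem)
  qed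
  with \<tau> show ?thesis by blast
qed

end

section \<open>Lower bounds for the driving noise\<close>

lemma prod_Basis_vec: "(\<Prod>b\<in>Basis. f (x \<bullet> b)) = (\<Prod>i\<in>UNIV. f ((x :: real ^ 'n::finite) $ i))"
proof -
  have B: "Basis = range (\<lambda>i::'n. axis i (1::real))" by (auto simp: Basis_vec_def)
  have inj: "inj (\<lambda>i::'n. axis i (1::real))" by (auto simp: inj_on_def axis_eq_axis)
  show ?thesis unfolding B prod.reindex[OF inj] by (simp add: inner_axis)
qed

lemma sets_std_gaussian [measurable_cong, simp]: "sets std_gaussian = sets borel"
  by (simp add: std_gaussian_def)

lemma space_std_gaussian [simp]: "space std_gaussian = UNIV"
  by (simp add: std_gaussian_def)

lemma borel_measurable_std_gaussian_density [measurable]: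
  "(\<lambda>x :: real ^ 'n::finite. ennreal (\<Prod>i\<in>UNIV. std_normal_density (x $ i))) \<in> borel_measurable borel"
  by measurable

lemma prob_space_std_gaussian: "prob_space (std_gaussian :: (real ^ 'n::finite) measure)"
proof
  have 1: "(\<integral>\<^sup>+x. ennreal (std_normal_density x) \<partial>lborel) = 1"
  proof -
    interpret prob_space "density lborel std_normal_density" by (rule prob_space_normal_density) simp
    show ?thesis using emeasure_space_1 by (simp add: emeasure_density)
  qed
  have dens: "ennreal (\<Prod>i\<in>UNIV. std_normal_density (x $ i)) = (\<Prod>b\<in>Basis. ennreal (std_normal_density (x \<bullet> b)))"
    for x :: "real ^ 'n"
    unfolding prod_Basis_vec[of "\<lambda>y. ennreal (std_normal_density y)" x] by (simp add: prod_ennreal)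
  have "emeasure std_gaussian (space (std_gaussian :: (real ^ 'n) measure))
      = (\<integral>\<^sup>+x. (\<Prod>b\<in>Basis. ennreal (std_normal_density ((x :: real ^ 'n) \<bullet> b))) \<partial>lborel)"
    by (simp add: std_gaussian_def emeasure_density dens)
  also have "\<dots> = (\<Prod>b\<in>(Basis :: (real ^ 'n) set). (\<integral>\<^sup>+x. ennreal (std_normal_density x) \<partial>lborel))"
    by (rule nn_integral_lborel_prod) auto
  also have "\<dots> = 1" by (simp add: 1)
  finally show "emeasure std_gaussian (space (std_gaussian :: (real ^ 'n) measure)) = 1" .
qed

lemma std_gaussian_lower:
  "\<exists>c>0. \<forall>h \<in> borel_measurable borel.
     ennreal c * (\<integral>\<^sup>+x. indicator (cball 0 M) x * h x \<partial>lborel) \<le> (\<integral>\<^sup>+x. h x \<partial>(std_gaussian :: (real ^ 'n::finite) measure))"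
proof -
  define c where "c = std_normal_density M ^ CARD('n)"
  have "c \<le> (\<Prod>i\<in>UNIV. std_normal_density (x $ i))" if "norm x \<le> M" for x :: "real ^ 'n"
  proof -
    have "std_normal_density M \<le> std_normal_density (x $ i)" for i
    proof -
      have "\<bar>x $ i\<bar> \<le> \<bar>M\<bar>" using component_le_norm_cart[of x i] that by simp
      then have "(x $ i)\<^sup>2 \<le> M\<^sup>2" by (simp add: abs_le_square_iff)
      then show ?thesis by (simp add: std_normal_density_def divide_right_mono)
    qed
    then have "(\<Prod>i\<in>(UNIV::'n set). std_normal_density M) \<le> (\<Prod>i\<in>UNIV. std_normal_density (x $ i))"
      by (intro prod_mono) (auto simp: normal_density_nonneg)
    then show ?thesis by (simp add: c_def)
  qed
  then have dens: "ennreal c * indicator (cball 0 M) x \<le> ennreal (\<Prod>i\<in>UNIV. std_normal_density (x $ i))" for x :: "real ^ 'n"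
    by (auto split: split_indicator intro: ennreal_leI)
  have "ennreal c * (\<integral>\<^sup>+x. indicator (cball 0 M) x * h x \<partial>lborel) \<le> (\<integral>\<^sup>+x. h x \<partial>std_gaussian)"
    if [measurable]: "h \<in> borel_measurable borel" for h :: "real ^ 'n \<Rightarrow> ennreal"
  proof -
    have [measurable]: "cball 0 M \<in> sets (borel :: (real ^ 'n) measure)" by simp
    have "ennreal c * (\<integral>\<^sup>+x. indicator (cball 0 M) x * h x \<partial>lborel)
        = (\<integral>\<^sup>+x. (ennreal c * indicator (cball 0 M) x) * h x \<partial>lborel)"
      by (subst nn_integral_cmult[symmetric]) (measurable, simp add: mult.assoc)
    also have "\<dots> \<le> (\<integral>\<^sup>+x. ennreal (\<Prod>i\<in>UNIV. std_normal_density (x $ i)) * h x \<partial>lborel)"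
      by (intro nn_integral_mono mult_right_mono dens) auto
    also have "\<dots> = (\<integral>\<^sup>+x. h x \<partial>std_gaussian)"
      unfolding std_gaussian_def by (subst nn_integral_density) auto
    finally show ?thesis .
  qed
  moreover have "c > 0" by (simp add: c_def normal_density_pos)
  ultimately show ?thesis by blast
qed

lemma exponential_interval_pos:
  assumes "0 < l" "0 \<le> a" "a < b"
  shows "\<exists>c>0. ennreal c \<le> emeasure (density lborel (exponential_density l)) {a..b}"
proof (intro exI conjI)
  show "0 < (l * exp (- b * l)) * (b - a)" using assms by simp
  have "ennreal ((l * exp (- b * l)) * (b - a)) = (\<integral>\<^sup>+x. ennreal (l * exp (- b * l)) * indicator {a..b} x \<partial>lborel)"
    using assms by (simp add: nn_integral_cmult_indicator ennreal_mult)
  also have "\<dots> \<le> (\<integral>\<^sup>+x. ennreal (exponential_density l x) * indicator {a..b} x \<partial>lborel)"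
    using assms by (intro nn_integral_mono)
      (auto split: split_indicator simp: exponential_density_def intro!: ennreal_leI mult_left_mono)
  also have "\<dots> = emeasure (density lborel (exponential_density l)) {a..b}"
    by (simp add: emeasure_density)
  finally show "ennreal ((l * exp (- b * l)) * (b - a)) \<le> emeasure (density lborel (exponential_density l)) {a..b}" .
qed

text \<open>The first coordinate of an independent and identically distributed sequence can be integrated out
  separately, the remaining ones forming a sequence with the same law.\<close>

lemma (in prob_space) nn_integral_sequence:
  assumes [measurable]: "f \<in> borel_measurable (Pi\<^sub>M (UNIV :: nat set) (\<lambda>_. M))"
  shows "(\<integral>\<^sup>+\<omega>. f \<omega> \<partial>(Pi\<^sub>M UNIV (\<lambda>_. M))) = (\<integral>\<^sup>+x. \<integral>\<^sup>+\<omega>. f (case_nat x \<omega>) \<partial>(Pi\<^sub>M UNIV (\<lambda>_. M)) \<partial>M)"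
proof -
  interpret S: sequence_space M ..
  interpret P: pair_sigma_finite M "\<Pi>\<^sub>M i::nat\<in>UNIV. M" ..
  have "(\<integral>\<^sup>+\<omega>. f \<omega> \<partial>S.S) = (\<integral>\<^sup>+X. f ((\<lambda>(s, \<omega>). case_nat s \<omega>) X) \<partial>(M \<Otimes>\<^sub>M S.S))"
    by (subst S.PiM_iter[symmetric]) (simp add: nn_integral_distr)
  also have "\<dots> = (\<integral>\<^sup>+x. \<integral>\<^sup>+\<omega>. f ((\<lambda>(s, \<omega>). case_nat s \<omega>) (x, \<omega>)) \<partial>S.S \<partial>M)"
    by (subst S.nn_integral_fst) simp_all
  finally show ?thesis by simp
qed

abbreviation noise_step :: "real \<Rightarrow> (real \<times> (real ^ 'n::finite)) measure" where
  "noise_step lam \<equiv> density lborel (exponential_density (1 / lam)) \<Otimes>\<^sub>M std_gaussian"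

lemma prob_space_noise_step:
  assumes "lam > 0"
  shows "prob_space (noise_step lam :: (real \<times> (real ^ 'n::finite)) measure)"
proof -
  interpret E: prob_space "density lborel (exponential_density (1 / lam))"
    using assms by (intro prob_space_exponential_density) simp
  interpret G: prob_space "std_gaussian :: (real ^ 'n) measure" by (rule prob_space_std_gaussian)
  interpret pair_prob_space "density lborel (exponential_density (1 / lam))" "std_gaussian :: (real ^ 'n) measure" ..
  show ?thesis by (rule P.prob_space_axioms)
qed

text \<open>Tonelli's theorem for two independent pairs of a waiting time (law \<open>E\<close>) and a Gaussian vector
  (law \<open>G\<close>): the waiting times are moved to the outside, so that the inner integral is over the two
  Gaussian vectors for frozen waiting times.\<close>

lemma nn_integral_two_steps:
  assumes "prob_space E" "prob_space G"
    and H[measurable]: "case_prod H \<in> borel_measurable ((E \<Otimes>\<^sub>M G) \<Otimes>\<^sub>M (E \<Otimes>\<^sub>M G))"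
  shows "(\<integral>\<^sup>+x. \<integral>\<^sup>+y. H x y \<partial>(E \<Otimes>\<^sub>M G) \<partial>(E \<Otimes>\<^sub>M G))
    = (\<integral>\<^sup>+a. \<integral>\<^sup>+b. \<integral>\<^sup>+\<xi>. \<integral>\<^sup>+\<zeta>. H (a, \<xi>) (b, \<zeta>) \<partial>G \<partial>G \<partial>E \<partial>E)"
proof -
  interpret E: prob_space E by fact
  interpret G: prob_space G by fact
  interpret GE: pair_sigma_finite G E ..
  interpret EG: pair_prob_space E G ..
  have H'[measurable]: "(\<lambda>u. H (f u) (g u)) \<in> borel_measurable M"
    if [measurable]: "f \<in> measurable M (E \<Otimes>\<^sub>M G)" "g \<in> measurable M (E \<Otimes>\<^sub>M G)" for f g and M :: "'z measure"
    using measurable_compose[OF measurable_Pair[OF that] H] by simp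
  have "(\<integral>\<^sup>+x. \<integral>\<^sup>+y. H x y \<partial>(E \<Otimes>\<^sub>M G) \<partial>(E \<Otimes>\<^sub>M G))
      = (\<integral>\<^sup>+a. \<integral>\<^sup>+\<xi>. \<integral>\<^sup>+y. H (a, \<xi>) y \<partial>(E \<Otimes>\<^sub>M G) \<partial>G \<partial>E)"
    by (subst G.nn_integral_fst[symmetric])
      (auto intro!: EG.P.borel_measurable_nn_integral H)
  also have "\<dots> = (\<integral>\<^sup>+a. \<integral>\<^sup>+\<xi>. \<integral>\<^sup>+b. \<integral>\<^sup>+\<zeta>. H (a, \<xi>) (b, \<zeta>) \<partial>G \<partial>E \<partial>G \<partial>E)"
  proof (intro nn_integral_cong)
    fix a \<xi> assume a[measurable]: "a \<in> space E" "\<xi> \<in> space G"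
    show "(\<integral>\<^sup>+y. H (a, \<xi>) y \<partial>(E \<Otimes>\<^sub>M G)) = (\<integral>\<^sup>+b. \<integral>\<^sup>+\<zeta>. H (a, \<xi>) (b, \<zeta>) \<partial>G \<partial>E)"
      by (subst G.nn_integral_fst[symmetric]) (measurable, simp_all add: space_pair_measure a)
  qed
  also have "\<dots> = (\<integral>\<^sup>+a. \<integral>\<^sup>+b. \<integral>\<^sup>+\<xi>. \<integral>\<^sup>+\<zeta>. H (a, \<xi>) (b, \<zeta>) \<partial>G \<partial>G \<partial>E \<partial>E)"
  proof (intro nn_integral_cong)
    fix a assume [measurable]: "a \<in> space E"
    show "(\<integral>\<^sup>+\<xi>. \<integral>\<^sup>+b. \<integral>\<^sup>+\<zeta>. H (a, \<xi>) (b, \<zeta>) \<partial>G \<partial>E \<partial>G) = (\<integral>\<^sup>+b. \<integral>\<^sup>+\<xi>. \<integral>\<^sup>+\<zeta>. H (a, \<xi>) (b, \<zeta>) \<partial>G \<partial>G \<partial>E)"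
      by (intro GE.Fubini'[symmetric]) measurable
  qed
  finally show ?thesis .
qed

section \<open>The process and its law\<close>

context nonneg_C2_potential
begin

lemma measurable_randomization [measurable (raw)]:
  fixes f :: "'a \<Rightarrow> real ^ 'n" and g :: "'a \<Rightarrow> 'n phase"
  assumes [measurable]: "f \<in> borel_measurable M" "g \<in> borel_measurable M"
  shows "(\<lambda>x. momentum_randomization \<phi> (f x) (g x)) \<in> borel_measurable M"
proof -
  have c: "continuous_on UNIV (\<lambda>u::(real ^ 'n) \<times> 'n phase. momentum_randomization \<phi> (fst u) (snd u))"
    unfolding momentum_randomization_def by (intro continuous_intros)
  from measurable_compose[OF borel_measurable_Pair[OF assms] borel_measurable_continuous_onI[OF c]]
  show ?thesis by simp
qed

text \<open>Without measurability the image measure that defines the law would be meaningless. The index of the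
  current jump interval is a measurable function into the natural numbers, and for a fixed index the
  state depends continuously on finitely many coordinates of the noise.\<close>

lemma measurable_rhmc_process:
  "rhmc_process \<Phi> \<phi> z t \<in> borel_measurable (rhmc_noise lam)"
proof -
  let ?S = "rhmc_noise lam :: (nat \<Rightarrow> real \<times> (real ^ 'n)) measure"
  have [measurable]: "(\<lambda>\<omega>. \<omega> n) \<in> measurable ?S (noise_step lam)" for n
    unfolding rhmc_noise_def by (rule measurable_component_singleton) simp
  have [measurable]: "(\<lambda>\<omega>. fst (\<omega> n)) \<in> borel_measurable ?S" "(\<lambda>\<omega>. snd (\<omega> n)) \<in> borel_measurable ?S" for n
  proof -
    have "fst \<in> borel_measurable (noise_step lam :: (real \<times> (real ^ 'n)) measure)"
      "snd \<in> borel_measurable (noise_step lam :: (real \<times> (real ^ 'n)) measure)"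
      by measurable
    then show "(\<lambda>\<omega>. fst (\<omega> n)) \<in> borel_measurable ?S" "(\<lambda>\<omega>. snd (\<omega> n)) \<in> borel_measurable ?S"
      by measurable
  qed
  have [measurable]: "(\<lambda>\<omega>. jump_time \<omega> n) \<in> borel_measurable ?S" for n
    unfolding jump_time_def by measurable
  have [measurable]: "(\<lambda>\<omega>. jump_state \<Phi> \<phi> z \<omega> n) \<in> borel_measurable ?S" for n
    by (induction n) (simp, simp only: jump_state.simps, measurable)
  have [measurable]: "(\<lambda>\<omega>. LEAST n. jump_time \<omega> n \<le> t \<and> t < jump_time \<omega> (Suc n)) \<in> measurable ?S (count_space UNIV)"
    by measurable
  show ?thesis unfolding rhmc_process_def Let_def
    by (rule measurable_compose_countable[where g = "\<lambda>\<omega>. LEAST n. jump_time \<omega> n \<le> t \<and> t < jump_time \<omega> (Suc n)"]) measurable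
qed

text \<open>On the event that exactly two jumps happen up to time \<open>t\<close>, the index chosen in the definition of
  the process is \<open>2\<close>.\<close>

lemma rhmc_process_two_jumps:
  assumes d: "0 < fst (\<omega> 0)" "0 < fst (\<omega> 1)" "fst (\<omega> 0) + fst (\<omega> 1) \<le> t" "t < fst (\<omega> 0) + fst (\<omega> 1) + fst (\<omega> 2)"
  shows "rhmc_process \<Phi> \<phi> z t \<omega>
    = two_jumps \<phi> (fst (\<omega> 0)) (fst (\<omega> 1)) (t - (fst (\<omega> 0) + fst (\<omega> 1))) z (snd (\<omega> 0), snd (\<omega> 1))"
proof -
  have T: "jump_time \<omega> 0 = 0" "jump_time \<omega> 1 = fst (\<omega> 0)" "jump_time \<omega> 2 = fst (\<omega> 0) + fst (\<omega> 1)"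
    "jump_time \<omega> 3 = fst (\<omega> 0) + fst (\<omega> 1) + fst (\<omega> 2)"
    by (auto simp: jump_time_def numeral_2_eq_2 numeral_3_eq_3)
  have "(LEAST n. jump_time \<omega> n \<le> t \<and> t < jump_time \<omega> (Suc n)) = 2"
  proof (rule Least_equality)
    show "jump_time \<omega> 2 \<le> t \<and> t < jump_time \<omega> (Suc 2)" using T d by (simp add: numeral_3_eq_3 numeral_2_eq_2)
    fix n assume n: "jump_time \<omega> n \<le> t \<and> t < jump_time \<omega> (Suc n)"
    have "n \<noteq> 0" using n T(2) d by (intro notI) simp
    moreover have "n \<noteq> 1" using n T d by (auto simp: numeral_2_eq_2)
    ultimately show "2 \<le> n" by linarith
  qed
  then show ?thesis
    unfolding rhmc_process_def Let_def by (simp add: T(3)) (simp add: numeral_2_eq_2)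
qed

text \<open>For frozen waiting times. The constant depends only on the Lipschitz constant \<open>L\<close> and the radius \<open>M\<close>
  of the ball of Gaussian vectors, which is what makes it uniform in the starting point and the
  waiting times.\<close>

lemma two_jumps_gaussian_lower:
  "\<exists>c>0. \<forall>s s' r z R A. L-lipschitz_on (cball 0 M) (two_jumps \<phi> s s' r z) \<longrightarrow>
      cball 0 R \<subseteq> two_jumps \<phi> s s' r z ` cball 0 M \<longrightarrow> A \<in> sets borel \<longrightarrow>
      ennreal c * emeasure lborel (A \<inter> cball 0 R)
        \<le> (\<integral>\<^sup>+\<xi>. \<integral>\<^sup>+\<zeta>. indicator A (two_jumps \<phi> s s' r z (\<xi>, \<zeta>)) \<partial>std_gaussian \<partial>std_gaussian)"
proof -
  obtain c where c: "c > 0" "\<And>h :: real ^ 'n \<Rightarrow> ennreal. h \<in> borel_measurable borel \<Longrightarrow>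
      ennreal c * (\<integral>\<^sup>+x. indicator (cball 0 M) x * h x \<partial>lborel) \<le> (\<integral>\<^sup>+x. h x \<partial>std_gaussian)"
    using std_gaussian_lower by metis
  define K where "K = \<bar>(2 * L * DIM('n phase)) ^ DIM('n phase)\<bar>"
  have K: "K \<ge> 0" by (simp add: K_def)
  \<comment> \<open>\<open>K\<close> may vanish, hence the summand \<open>1\<close>.\<close>
  define \<kappa> where "\<kappa> = c * c / (K + 1)"
  have \<kappa>: "\<kappa> > 0" "\<kappa> * K \<le> c * c" using c(1) K by (auto simp: \<kappa>_def field_simps)
  have "ennreal \<kappa> * emeasure lborel (A \<inter> cball 0 R)
        \<le> (\<integral>\<^sup>+\<xi>. \<integral>\<^sup>+\<zeta>. indicator A (f (\<xi>, \<zeta>)) \<partial>std_gaussian \<partial>std_gaussian)"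
    if lip: "L-lipschitz_on (cball 0 M) f" and onto: "cball 0 R \<subseteq> f ` cball 0 M"
      and A[measurable]: "A \<in> sets borel" and f[measurable]: "f \<in> borel_measurable borel"
    for f :: "'n phase \<Rightarrow> 'n phase" and R A
  proof -
    have [measurable]: "cball 0 M \<in> sets (borel :: (real ^ 'n) measure)" by simp
    have [measurable (raw)]: "(\<lambda>x. f (g x, h x)) \<in> borel_measurable N"
      if "g \<in> borel_measurable N" "h \<in> borel_measurable N" for g h and N :: "'z measure"
      by (rule measurable_compose[OF borel_measurable_Pair[OF that] f])
    define S where "S = cball 0 M \<inter> f -` A"
    have S: "S \<in> sets borel" using measurable_sets[OF f A] by (simp add: S_def)
    have "emeasure lborel (A \<inter> cball 0 R) \<le> ennreal ((2 * L * DIM('n phase)) ^ DIM('n phase)) * emeasure lborel S"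
      using onto by (intro emeasure_le_lipschitz_image[OF lipschitz_on_subset[OF lip] _ S])
        (auto simp: S_def intro: bounded_subset[OF bounded_cball])
    also have "\<dots> \<le> ennreal K * emeasure lborel S"
      by (intro mult_right_mono ennreal_leI) (auto simp: K_def)
    finally have "ennreal \<kappa> * emeasure lborel (A \<inter> cball 0 R) \<le> ennreal \<kappa> * (ennreal K * emeasure lborel S)"
      by (intro mult_left_mono) auto
    also have "\<dots> = ennreal (\<kappa> * K) * emeasure lborel S"
      using \<kappa>(1) K by (simp add: ennreal_mult mult.assoc)
    also have "\<dots> \<le> ennreal (c * c) * emeasure lborel S"
      using \<kappa>(2) by (intro mult_right_mono ennreal_leI) auto
    also have "emeasure lborel S = (\<integral>\<^sup>+\<xi>. \<integral>\<^sup>+\<zeta>. indicator S (\<xi>, \<zeta>) \<partial>lborel \<partial>lborel)"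
    proof -
      have "S \<in> sets (lborel \<Otimes>\<^sub>M (lborel :: (real ^ 'n) measure))" unfolding lborel_prod using S by simp
      from lborel.emeasure_pair_measure[OF this] show ?thesis by (simp add: lborel_prod)
    qed
    also have "\<dots> \<le> (\<integral>\<^sup>+\<xi>. indicator (cball 0 M) \<xi> *
        (\<integral>\<^sup>+\<zeta>. indicator (cball 0 M) \<zeta> * indicator A (f (\<xi>, \<zeta>)) \<partial>lborel) \<partial>lborel)"
    proof (intro nn_integral_mono)
      fix \<xi> :: "real ^ 'n"
      have "indicator S (\<xi>, \<zeta>) \<le> indicator (cball 0 M) \<xi> * (indicator (cball 0 M) \<zeta> * indicator A (f (\<xi>, \<zeta>)) :: ennreal)" for \<zeta>
        using norm_fst_le[of \<xi> \<zeta>] norm_snd_le[of \<zeta> \<xi>] by (auto simp: S_def split: split_indicator)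
      then have "(\<integral>\<^sup>+\<zeta>. indicator S (\<xi>, \<zeta>) \<partial>lborel)
          \<le> (\<integral>\<^sup>+\<zeta>. indicator (cball 0 M) \<xi> * (indicator (cball 0 M) \<zeta> * indicator A (f (\<xi>, \<zeta>))) \<partial>lborel)"
        by (intro nn_integral_mono)
      also have "\<dots> = indicator (cball 0 M) \<xi> * (\<integral>\<^sup>+\<zeta>. indicator (cball 0 M) \<zeta> * indicator A (f (\<xi>, \<zeta>)) \<partial>lborel)"
        by (intro nn_integral_cmult) measurable
      finally show "(\<integral>\<^sup>+\<zeta>. indicator S (\<xi>, \<zeta>) \<partial>lborel) \<le> \<dots>" .
    qed
    also have "ennreal (c * c) * \<dots> = ennreal c * (\<integral>\<^sup>+\<xi>. indicator (cball 0 M) \<xi> *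
        (ennreal c * (\<integral>\<^sup>+\<zeta>. indicator (cball 0 M) \<zeta> * indicator A (f (\<xi>, \<zeta>)) \<partial>lborel)) \<partial>lborel)"
    proof -
      define h where "h \<xi> = (\<integral>\<^sup>+\<zeta>. indicator (cball 0 M) \<zeta> * indicator A (f (\<xi>, \<zeta>)) \<partial>lborel)" for \<xi>
      have h: "h \<in> borel_measurable borel" unfolding h_def by measurable
      have "ennreal c * (\<integral>\<^sup>+\<xi>. indicator (cball 0 M) \<xi> * h \<xi> \<partial>lborel)
          = (\<integral>\<^sup>+\<xi>. ennreal c * (indicator (cball 0 M) \<xi> * h \<xi>) \<partial>lborel)"
        using h by (intro nn_integral_cmult[symmetric]) measurable
      also have "\<dots> = (\<integral>\<^sup>+\<xi>. indicator (cball 0 M) \<xi> * (ennreal c * h \<xi>) \<partial>lborel)"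
        by (simp only: mult.left_commute)
      finally show ?thesis using c(1) unfolding h_def by (simp add: ennreal_mult mult.assoc)
    qed
    also have "\<dots> \<le> ennreal c * (\<integral>\<^sup>+\<xi>. indicator (cball 0 M) \<xi> *
        (\<integral>\<^sup>+\<zeta>. indicator A (f (\<xi>, \<zeta>)) \<partial>std_gaussian) \<partial>lborel)"
      by (intro mult_left_mono nn_integral_mono c(2)) auto
    also have "\<dots> \<le> (\<integral>\<^sup>+\<xi>. \<integral>\<^sup>+\<zeta>. indicator A (f (\<xi>, \<zeta>)) \<partial>std_gaussian \<partial>std_gaussian)"
    proof (rule c(2))
      interpret G: prob_space "std_gaussian :: (real ^ 'n) measure" by (rule prob_space_std_gaussian)
      show "(\<lambda>\<xi>. \<integral>\<^sup>+\<zeta>. indicator A (f (\<xi>, \<zeta>)) \<partial>std_gaussian) \<in> borel_measurable borel"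
        by measurable
    qed
    finally show ?thesis by (simp add: mult_left_mono)
  qed
  moreover have "two_jumps \<phi> s s' r z \<in> borel_measurable borel" for s s' r z
    unfolding momentum_randomization_def
    by (intro borel_measurable_continuous_onI continuous_intros)
  ultimately show ?thesis using \<kappa>(1) by blast
qed

text \<open>If the first two waiting times lie between \<open>\<tau> / 2\<close> and \<open>\<tau>\<close> and the third one is at least \<open>3 \<tau>\<close>, then
  the second jump happens no later than \<open>2 \<tau>\<close> and the third one only after \<open>3 \<tau>\<close>. The upper end
  \<open>4 \<tau>\<close> keeps the exponential density bounded away from zero on the interval.\<close>

lemma rhmc_law_lower:
  assumes lam: "lam > 0" and \<tau>: "\<tau> > 0"
    and low: "\<And>a b. \<tau> / 2 \<le> a \<Longrightarrow> a \<le> \<tau> \<Longrightarrow> \<tau> / 2 \<le> b \<Longrightarrow> b \<le> \<tau> \<Longrightarrow>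
        C \<le> (\<integral>\<^sup>+\<xi>. \<integral>\<^sup>+\<zeta>. indicator A (two_jumps \<phi> a b (3 * \<tau> - (a + b)) z (\<xi>, \<zeta>)) \<partial>std_gaussian \<partial>std_gaussian)"
    and A[measurable]: "A \<in> sets borel"
  defines "E \<equiv> density lborel (exponential_density (1 / lam))"
  shows "emeasure E {\<tau> / 2..\<tau>} * (emeasure E {\<tau> / 2..\<tau>} * (emeasure E {3 * \<tau>..4 * \<tau>} * C))
     \<le> emeasure (rhmc_law lam \<phi> \<Phi> (3 * \<tau>) z) A"
proof -
  let ?G = "std_gaussian :: (real ^ 'n) measure"
  let ?N = "E \<Otimes>\<^sub>M ?G"
  let ?P = "Pi\<^sub>M (UNIV :: nat set) (\<lambda>_. ?N)"
  have P: "?P = rhmc_noise lam" by (simp add: rhmc_noise_def E_def)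
  interpret E: prob_space E unfolding E_def using lam by (intro prob_space_exponential_density) simp
  interpret G: prob_space ?G by (rule prob_space_std_gaussian)
  interpret N: prob_space ?N unfolding E_def by (rule prob_space_noise_step[OF lam])
  interpret PP: prob_space ?P by (intro prob_space_PiM N.prob_space_axioms)
  have [measurable_cong]: "sets E = sets borel" by (simp add: E_def)
  define f where "f \<omega> = (indicator A (rhmc_process \<Phi> \<phi> z (3 * \<tau>) \<omega>) :: ennreal)" for \<omega>
  have [measurable]: "rhmc_process \<Phi> \<phi> z (3 * \<tau>) \<in> borel_measurable ?P"
    unfolding P by (rule measurable_rhmc_process)
  have f[measurable]: "f \<in> borel_measurable ?P" unfolding f_def by measurable
  define I J where "I = {\<tau> / 2..\<tau>}" and "J = {3 * \<tau>..4 * \<tau>}"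
  have [measurable]: "I \<in> sets borel" "J \<in> sets borel" by (auto simp: I_def J_def)
  define g where "g x y = (indicator I (fst x) * (indicator I (fst y) *
      (emeasure E J * indicator A (two_jumps \<phi> (fst x) (fst y) (3 * \<tau> - (fst x + fst y)) z (snd x, snd y)))) :: ennreal)"
    for x y :: "real \<times> (real ^ 'n)"
  have g[measurable]: "case_prod g \<in> borel_measurable (?N \<Otimes>\<^sub>M ?N)"
    unfolding g_def by measurable
  have "(\<integral>\<^sup>+a. indicator I a * (\<integral>\<^sup>+b. indicator I b * (emeasure E J * C) \<partial>E) \<partial>E)
      \<le> (\<integral>\<^sup>+a. \<integral>\<^sup>+b. \<integral>\<^sup>+\<xi>. \<integral>\<^sup>+\<zeta>. g (a, \<xi>) (b, \<zeta>) \<partial>?G \<partial>?G \<partial>E \<partial>E)"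
  proof (intro nn_integral_mono)
    fix a
    show "indicator I a * (\<integral>\<^sup>+b. indicator I b * (emeasure E J * C) \<partial>E)
        \<le> (\<integral>\<^sup>+b. \<integral>\<^sup>+\<xi>. \<integral>\<^sup>+\<zeta>. g (a, \<xi>) (b, \<zeta>) \<partial>?G \<partial>?G \<partial>E)"
    proof (cases "a \<in> I")
      case True
      have "indicator I b * (emeasure E J * C) \<le> (\<integral>\<^sup>+\<xi>. \<integral>\<^sup>+\<zeta>. g (a, \<xi>) (b, \<zeta>) \<partial>?G \<partial>?G)" for b
      proof (cases "b \<in> I")
        case b: True
        have "emeasure E J * C \<le> emeasure E J *
            (\<integral>\<^sup>+\<xi>. \<integral>\<^sup>+\<zeta>. indicator A (two_jumps \<phi> a b (3 * \<tau> - (a + b)) z (\<xi>, \<zeta>)) \<partial>?G \<partial>?G)"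
          using True b by (intro mult_left_mono low) (auto simp: I_def)
        also have "\<dots> = (\<integral>\<^sup>+\<xi>. \<integral>\<^sup>+\<zeta>. g (a, \<xi>) (b, \<zeta>) \<partial>?G \<partial>?G)"
          using True b unfolding g_def
          by (simp add: nn_integral_cmult[symmetric])
        finally show ?thesis using b by simp
      qed simp
      then show ?thesis using True by (auto intro!: nn_integral_mono)
    qed simp
  qed
  also have "(\<integral>\<^sup>+a. indicator I a * (\<integral>\<^sup>+b. indicator I b * (emeasure E J * C) \<partial>E) \<partial>E)
      = emeasure E I * (emeasure E I * (emeasure E J * C))"
    by (simp add: nn_integral_multc)
  also have "(\<integral>\<^sup>+a. \<integral>\<^sup>+b. \<integral>\<^sup>+\<xi>. \<integral>\<^sup>+\<zeta>. g (a, \<xi>) (b, \<zeta>) \<partial>?G \<partial>?G \<partial>E \<partial>E) = (\<integral>\<^sup>+x. \<integral>\<^sup>+y. g x y \<partial>?N \<partial>?N)"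
    by (rule nn_integral_two_steps[symmetric, OF E.prob_space_axioms G.prob_space_axioms g])
  also have "\<dots> \<le> (\<integral>\<^sup>+x. \<integral>\<^sup>+y. \<integral>\<^sup>+u. \<integral>\<^sup>+\<omega>. f (case_nat x (case_nat y (case_nat u \<omega>))) \<partial>?P \<partial>?N \<partial>?N \<partial>?N)"
  proof (intro nn_integral_mono)
    fix x y
    define k where "k = (indicator I (fst x) * (indicator I (fst y) *
        indicator A (two_jumps \<phi> (fst x) (fst y) (3 * \<tau> - (fst x + fst y)) z (snd x, snd y))) :: ennreal)"
    have "g x y = emeasure E J * k" by (simp add: g_def k_def ac_simps)
    also have "emeasure E J = (\<integral>\<^sup>+u. indicator J (fst u) \<partial>?N)"
      by (subst G.nn_integral_fst[symmetric]) (measurable, simp add: G.emeasure_space_1[simplified])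
    also have "\<dots> * k = (\<integral>\<^sup>+u. indicator J (fst u) * k \<partial>?N)"
      by (rule nn_integral_multc[symmetric]) measurable
    also have "\<dots> = (\<integral>\<^sup>+u. \<integral>\<^sup>+\<omega>. indicator J (fst u) * k \<partial>?P \<partial>?N)"
      by (simp add: PP.emeasure_space_1)
    also have "\<dots> \<le> (\<integral>\<^sup>+u. \<integral>\<^sup>+\<omega>. f (case_nat x (case_nat y (case_nat u \<omega>))) \<partial>?P \<partial>?N)"
    proof (intro nn_integral_mono)
      fix u \<omega>
      let ?w = "case_nat x (case_nat y (case_nat u \<omega>))"
      show "indicator J (fst u) * k \<le> f ?w"
      proof (cases "fst x \<in> I \<and> fst y \<in> I \<and> fst u \<in> J")
        case True
        have w: "?w 0 = x" "?w 1 = y" "?w 2 = u" by (simp_all add: numeral_2_eq_2)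
        have "rhmc_process \<Phi> \<phi> z (3 * \<tau>) ?w
            = two_jumps \<phi> (fst x) (fst y) (3 * \<tau> - (fst x + fst y)) z (snd x, snd y)"
          using rhmc_process_two_jumps[of ?w "3 * \<tau>" \<phi> z] True \<tau> unfolding w by (auto simp: I_def J_def)
        then show ?thesis using True by (simp add: f_def k_def)
      qed (auto simp: k_def)
    qed
    finally show "g x y \<le> \<dots>" .
  qed
  also have "\<dots> = (\<integral>\<^sup>+\<omega>. f \<omega> \<partial>?P)"
    by (simp add: N.nn_integral_sequence[of f] N.nn_integral_sequence[of "\<lambda>\<omega>. f (case_nat _ \<omega>)"]
        N.nn_integral_sequence[of "\<lambda>\<omega>. f (case_nat _ (case_nat _ \<omega>))"] cong: nn_integral_cong)
  also have "\<dots> = emeasure (rhmc_law lam \<phi> \<Phi> (3 * \<tau>) z) A"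
  proof -
    have "emeasure (rhmc_law lam \<phi> \<Phi> (3 * \<tau>) z) A = (\<integral>\<^sup>+y. indicator A y \<partial>distr ?P borel (rhmc_process \<Phi> \<phi> z (3 * \<tau>)))"
      using A by (simp add: rhmc_law_def P)
    also have "\<dots> = (\<integral>\<^sup>+\<omega>. f \<omega> \<partial>?P)"
      unfolding f_def by (subst nn_integral_distr) auto
    finally show ?thesis by simp
  qed
  finally show ?thesis by (simp add: I_def J_def)
qed

lemma rhmc_minorization_lborel:
  assumes lam: "lam > 0" and sin: "sin \<phi> > 0"
  shows "\<exists>\<epsilon>>0. \<exists>t>0. \<forall>z A. norm z \<le> R \<longrightarrow> A \<in> sets borel \<longrightarrow>
      ennreal \<epsilon> * emeasure lborel (A \<inter> cball 0 R) \<le> emeasure (rhmc_law lam \<phi> \<Phi> t z) A"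
proof -
  let ?E = "density lborel (exponential_density (1 / lam))"
  obtain \<tau> M where \<tau>: "0 < \<tau>" "\<tau> \<le> 1 / 2"
    and onto: "\<And>s s' r z. \<tau> / 2 \<le> s \<Longrightarrow> s \<le> \<tau> \<Longrightarrow> \<tau> / 2 \<le> s' \<Longrightarrow> s' \<le> \<tau> \<Longrightarrow> \<bar>r\<bar> \<le> 1 \<Longrightarrow> norm z \<le> R \<Longrightarrow>
        cball 0 R \<subseteq> two_jumps \<phi> s s' r z ` cball 0 M"
    using two_jumps_onto[OF sin, of R] by blast
  obtain L where L: "\<And>s s' r z. \<bar>s\<bar> \<le> 1 \<Longrightarrow> \<bar>s'\<bar> \<le> 1 \<Longrightarrow> \<bar>r\<bar> \<le> 1 \<Longrightarrow> norm z \<le> R \<Longrightarrow>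
      L-lipschitz_on (cball 0 M) (two_jumps \<phi> s s' r z)"
    using two_jumps_lipschitz[of 1 R M \<phi>] by blast
  obtain c where c: "c > 0" "\<And>s s' r z A. L-lipschitz_on (cball 0 M) (two_jumps \<phi> s s' r z) \<Longrightarrow>
      cball 0 R \<subseteq> two_jumps \<phi> s s' r z ` cball 0 M \<Longrightarrow> A \<in> sets borel \<Longrightarrow>
      ennreal c * emeasure lborel (A \<inter> cball 0 R)
        \<le> (\<integral>\<^sup>+\<xi>. \<integral>\<^sup>+\<zeta>. indicator A (two_jumps \<phi> s s' r z (\<xi>, \<zeta>)) \<partial>std_gaussian \<partial>std_gaussian)"
    using two_jumps_gaussian_lower[of L M \<phi>] by blast
  obtain i where i: "i > 0" "ennreal i \<le> emeasure ?E {\<tau> / 2..\<tau>}"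
    using exponential_interval_pos[of "1 / lam" "\<tau> / 2" \<tau>] lam \<tau> by auto
  obtain j where j: "j > 0" "ennreal j \<le> emeasure ?E {3 * \<tau>..4 * \<tau>}"
    using exponential_interval_pos[of "1 / lam" "3 * \<tau>" "4 * \<tau>"] lam \<tau> by auto
  have "ennreal (i * (i * (j * c))) * emeasure lborel (A \<inter> cball 0 R) \<le> emeasure (rhmc_law lam \<phi> \<Phi> (3 * \<tau>) z) A"
    if z: "norm z \<le> R" and A: "A \<in> sets borel" for z A
  proof -
    have "ennreal (i * (i * (j * c))) * emeasure lborel (A \<inter> cball 0 R)
        = ennreal i * (ennreal i * (ennreal j * (ennreal c * emeasure lborel (A \<inter> cball 0 R))))"
      using i(1) j(1) c(1) by (simp add: ennreal_mult mult.assoc)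
    also have "\<dots> \<le> emeasure ?E {\<tau> / 2..\<tau>} * (emeasure ?E {\<tau> / 2..\<tau>} *
        (emeasure ?E {3 * \<tau>..4 * \<tau>} * (ennreal c * emeasure lborel (A \<inter> cball 0 R))))"
      by (intro mult_mono i(2) j(2)) auto
    also have "\<dots> \<le> emeasure (rhmc_law lam \<phi> \<Phi> (3 * \<tau>) z) A"
      using \<tau> z by (intro rhmc_law_lower lam A c(2) onto L) auto
    finally show ?thesis .
  qed
  then show ?thesis
    using i(1) j(1) c(1) \<tau>(1) by (intro exI[of _ "i * (i * (j * c))"] conjI exI[of _ "3 * \<tau>"]) auto
qed

end

section \<open>The minorization condition\<close>

theorem proposition3p7:
  fixes lam \<phi> c1 c2 :: real
    and \<Phi> :: "(real ^ 'n::finite) \<Rightarrow> real"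
    and \<Omega> :: "'n phase set"
  assumes "lam > 0" and "0 < \<phi>" and "\<phi> \<le> pi / 2"
    and "c1 = (1 / lam) / 4 * (sin \<phi>)\<^sup>2"
    and "c2 = (1 / lam) * c1 * (1 - cos \<phi>)"
    and "C2 \<Phi>"
    and "\<And>q. \<Phi> q \<ge> 0"
    and "integrable lborel (\<lambda>q. (norm q)\<^sup>2 * exp (- \<Phi> q))"
    and "\<exists>a b. a > 0 \<and> 0 < b \<and> b < 1 \<and>
           (\<forall>q. 1 / 2 * (gradient \<Phi> q \<bullet> q) \<ge>
                b * \<Phi> q + ((c1 * b)\<^sup>2 + c2 * b * (1 - b)) / (2 * (1 - b)) * (norm q)\<^sup>2 - a)"
    and "compact \<Omega>"
  shows "\<exists>(\<eta> :: 'n phase measure) \<epsilon> t.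
           prob_space \<eta> \<and> sets \<eta> = sets borel \<and>
           (emeasure lborel \<Omega> > 0 \<longrightarrow> emeasure \<eta> \<Omega> = 1) \<and>
           \<epsilon> > 0 \<and> t > 0 \<and>
           (\<forall>z\<in>\<Omega>. \<forall>A\<in>sets borel.
              emeasure (rhmc_law lam \<phi> \<Phi> t z) A \<ge> ennreal \<epsilon> * emeasure \<eta> A)"
proof -
  interpret nonneg_C2_potential \<Phi> by unfold_locales fact+
  have sin: "sin \<phi> > 0" using assms(2,3) by (intro sin_gt_zero) (use pi_gt_zero in linarith)+
  obtain R where R: "R > 0" "\<Omega> \<subseteq> cball 0 R"
    using compact_imp_bounded[OF \<open>compact \<Omega>\<close>] unfolding bounded_pos
    by (auto simp: subset_iff)
  obtain \<epsilon> t where \<epsilon>: "\<epsilon> > 0" and t: "t > 0"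
    and minor: "\<And>z A. norm z \<le> R \<Longrightarrow> A \<in> sets borel \<Longrightarrow>
      ennreal \<epsilon> * emeasure lborel (A \<inter> cball 0 R) \<le> emeasure (rhmc_law lam \<phi> \<Phi> t z) A"
    using rhmc_minorization_lborel[OF \<open>lam > 0\<close> sin, of R] by blast
  \<comment> \<open>The measure has to live on \<open>\<Omega>\<close> only if \<open>\<Omega>\<close> has positive volume.\<close>
  define W where "W = (if emeasure lborel \<Omega> > 0 then \<Omega> else cball 0 R)"
  have W_sets: "W \<in> sets borel" using \<open>compact \<Omega>\<close> by (auto simp: W_def borel_compact)
  have W_sub: "W \<subseteq> cball 0 R" using R(2) by (auto simp: W_def)
  have W_pos: "emeasure lborel W > 0" using R(1) by (auto simp: W_def emeasure_cball unit_ball_vol_pos)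
  have W_fin: "emeasure lborel W < \<infinity>"
    using emeasure_bounded_finite[OF bounded_subset[OF bounded_cball W_sub]] .
  define m where "m = measure lborel W"
  have m: "emeasure lborel W = ennreal m" "m > 0"
    using W_pos W_fin by (auto simp: m_def emeasure_eq_ennreal_measure less_top[symmetric] zero_less_measure_iff)
  define \<eta> where "\<eta> = uniform_measure lborel W"
  have \<eta>: "emeasure \<eta> A = emeasure lborel (W \<inter> A) / emeasure lborel W" if "A \<in> sets borel" for A
    unfolding \<eta>_def using that W_sets by (intro emeasure_uniform_measure) auto
  show ?thesis
  proof (rule exI[of _ \<eta>], rule exI[of _ "\<epsilon> * m"], rule exI[of _ t], intro conjI ballI impI)
    show "prob_space \<eta>" unfolding \<eta>_def
      using W_pos W_fin by (intro prob_space_uniform_measure) auto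
    show "sets \<eta> = sets borel" by (simp add: \<eta>_def)
    show "emeasure \<eta> \<Omega> = 1" if "emeasure lborel \<Omega> > 0"
    proof -
      have "W = \<Omega>" using that by (simp add: W_def)
      then show ?thesis using \<eta>[OF W_sets] m by (simp add: ennreal_divide_self)
    qed
    show "\<epsilon> * m > 0" "t > 0" using \<epsilon> m t by auto
    fix z A assume z: "z \<in> \<Omega>" and A: "A \<in> sets (borel :: 'n phase measure)"
    have "ennreal m * emeasure \<eta> A = emeasure lborel (W \<inter> A) * ennreal m / ennreal m"
      unfolding \<eta>[OF A] m(1) ennreal_times_divide by (simp only: mult.commute)
    also have "\<dots> = emeasure lborel (W \<inter> A)"
      using m(2) by (intro ennreal_mult_divide_eq) auto
    finally have "ennreal (\<epsilon> * m) * emeasure \<eta> A = ennreal \<epsilon> * emeasure lborel (W \<inter> A)"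
      using \<epsilon> m(2) by (simp add: ennreal_mult mult.assoc)
    also have "\<dots> \<le> ennreal \<epsilon> * emeasure lborel (A \<inter> cball 0 R)"
      using W_sub A by (intro mult_left_mono emeasure_mono) auto
    also have "\<dots> \<le> emeasure (rhmc_law lam \<phi> \<Phi> t z) A"
      using R(2) z A by (intro minor) auto
    finally show "ennreal (\<epsilon> * m) * emeasure \<eta> A \<le> emeasure (rhmc_law lam \<phi> \<Phi> t z) A" .
  qed
qed

end
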